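(* Let $X=(X_t)_{t\ge 0}$ be a real-valued (one-dimensional) Lévy process with $X_0=0$ almost surely, $\mathbb{E}[X_1]=0$ and $\sigma:=\mathbb{E}[X_1^2]^{1/2}\in(0,\infty)$. Let $\nu$ be the Lévy measure of $X$. If $\nu$ is nontrivial (i.e. $\nu\neq 0$), let $\kappa\ge 1$ be any real number such that $0<\nu((-\kappa,\kappa))\le\infty$; otherwise set $\kappa:=1$. For $t>0$ define $\sigma_t\ge 0$ by $$\sigma_t^2:=\sigma^2-\int_{\mathbb{R}\setminus(-\kappa\sqrt{t},\,\kappa\sqrt{t})}x^2\,\nu(\mathrm{d}x).$$ Then $$\int_1^\infty \sup_{x\in\mathbb{R}}\left|\mathbb{P}\left(\frac{X_t}{\sqrt{t}}\le x\right)-\Phi\left(\frac{x}{\sigma_t}\right)\right|\frac{\mathrm{d}t}{t}<\infty .$$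
   Context: $\Phi$ denotes the distribution function of a standard normal random variable: $\Phi(x)=\int_{-\infty}^x \frac{1}{\sqrt{2\pi}}e^{-u^2/2}\,\mathrm{d}u$. The Lévy measure $\nu$ of $X$ is the measure on $\mathbb{R}$ (with $\nu(\{0\})=0$ and $\int_{\mathbb{R}}\min\{1,x^2\}\,\nu(\mathrm{d}x)<\infty$) appearing in the Lévy–Khintchine generating triplet of $X$. The choice of $\kappa$ serves to ensure $\sigma_t>0$ for $t\ge 1$, so that $\Phi(x/\sigma_t)$ is well defined. *)

theory Defs
  imports "HOL-Probability.Probability"
begin

text \<open>
  Only the values of \<open>X\<close> at times \<open>t \<ge> 0\<close> matter; \<open>X t\<close> for \<open>t < 0\<close> is junk and unconstrained.
\<close>

locale levy_process = prob_space M for M :: "'a measure" +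
  fixes X :: "real \<Rightarrow> 'a \<Rightarrow> real"
  assumes measurable_X: "\<And>t. 0 \<le> t \<Longrightarrow> X t \<in> borel_measurable M"
    and start_zero: "AE \<omega> in M. X 0 \<omega> = 0"
    and indep_increments:
      "\<And>(n::nat) (s::nat \<Rightarrow> real). 0 \<le> s 0 \<Longrightarrow> strict_mono_on {..n} s \<Longrightarrow>
         indep_vars (\<lambda>_. borel) (\<lambda>k \<omega>. X (s (Suc k)) \<omega> - X (s k) \<omega>) {..<n}"
    and stationary_increments:
      "\<And>s t. 0 \<le> s \<Longrightarrow> 0 \<le> t \<Longrightarrow>
         distr M borel (\<lambda>\<omega>. X (s + t) \<omega> - X s \<omega>) = distr M borel (X t)"
    and stochastically_continuous:
      "\<And>s \<epsilon>. 0 \<le> s \<Longrightarrow> 0 < \<epsilon> \<Longrightarrow>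
         ((\<lambda>t. prob {\<omega> \<in> space M. \<epsilon> < \<bar>X t \<omega> - X s \<omega>\<bar>}) \<longlongrightarrow> 0) (at s within {0..})"
    and cadlag:
      "AE \<omega> in M. \<forall>t\<ge>0. ((\<lambda>s. X s \<omega>) \<longlongrightarrow> X t \<omega>) (at_right t) \<and>
         (0 < t \<longrightarrow> (\<exists>l. ((\<lambda>s. X s \<omega>) \<longlongrightarrow> l) (at_left t)))"

definition levy_measure :: "real measure \<Rightarrow> bool" where
  "levy_measure \<nu> \<longleftrightarrow>
     sets \<nu> = sets borel \<and> emeasure \<nu> {0} = 0 \<and> (\<integral>\<^sup>+ x. ennreal (min 1 (x\<^sup>2)) \<partial>\<nu>) < \<infinity>"

text \<open>
  The cutoff function is the indicator of \<open>(-1, 1)\<close>; another choice changes only the drift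
  \<open>\<gamma>\<close>, not \<open>\<nu>\<close>. The parameter \<open>a\<close> is the variance (not the standard deviation) of the
  Gaussian component.
\<close>

definition levy_khintchine_exponent :: "real \<Rightarrow> real \<Rightarrow> real measure \<Rightarrow> real \<Rightarrow> complex" where
  "levy_khintchine_exponent \<gamma> a \<nu> u =
     \<i> * of_real (\<gamma> * u) - of_real (a * u\<^sup>2 / 2) +
     (CLINT x|\<nu>. iexp (u * x) - 1 - \<i> * of_real (u * x * indicator {-1<..<1} x))"

definition generating_triplet ::
  "'a measure \<Rightarrow> (real \<Rightarrow> 'a \<Rightarrow> real) \<Rightarrow> real \<Rightarrow> real \<Rightarrow> real measure \<Rightarrow> bool" where
  "generating_triplet M X \<gamma> a \<nu> \<longleftrightarrow>
     0 \<le> a \<and> levy_measure \<nu> \<and>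
     (\<forall>t\<ge>0. \<forall>u. char (distr M borel (X t)) u
        = exp (of_real t * levy_khintchine_exponent \<gamma> a \<nu> u))"

definition levy_measure_of :: "'a measure \<Rightarrow> (real \<Rightarrow> 'a \<Rightarrow> real) \<Rightarrow> real measure \<Rightarrow> bool" where
  "levy_measure_of M X \<nu> \<longleftrightarrow> (\<exists>\<gamma> a. generating_triplet M X \<gamma> a \<nu>)"

text \<open>
  When \<open>\<nu>\<close> is the Levy measure of a process with variance \<open>\<sigma>\<^sup>2\<close> at time one, the
  integral below is finite and at most \<open>\<sigma>\<^sup>2\<close>, so this is the nonnegative root.
\<close>

definition truncated_sigma :: "real measure \<Rightarrow> real \<Rightarrow> real \<Rightarrow> real \<Rightarrow> real" where
  "truncated_sigma \<nu> \<kappa> \<sigma> t =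
     sqrt (\<sigma>\<^sup>2 - (LINT x:(- {- \<kappa> * sqrt t <..< \<kappa> * sqrt t})|\<nu>. x\<^sup>2))"

definition std_normal_cdf :: "real \<Rightarrow> real" ("\<Phi>") where
  "\<Phi> x = (LINT u:{..x}|lborel. 1 / sqrt (2 * pi) * exp (- u\<^sup>2 / 2))"

end

theory Submission
  imports Defs
begin

text \<open>
  The proof works with characteristic functions only. The process has finite variance and mean
  zero, so the Levy--Khintchine exponent takes the centred form
  \<open>\<psi> u = - a u\<^sup>2 / 2 + (\<integral> exp (\<i> u x) - 1 - \<i> u x \<nu>(dx))\<close>, with \<open>a + \<integral> x\<^sup>2 \<nu>(dx) = \<sigma>\<^sup>2\<close>
  (\<open>levy_measure_second_moment\<close>), and \<open>X t / sqrt t\<close> has the exponent \<open>t \<psi> (u / sqrt t)\<close>. This is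
  again an exponent of the same form, for the Levy measure \<open>N\<close> obtained from \<open>\<nu>\<close> by
  dividing the jumps by \<open>sqrt t\<close> and multiplying the mass by \<open>t\<close>. The variance \<open>(\<sigma>\<^sub>t)\<^sup>2\<close> is then
  \<open>a\<close> plus the second moment of \<open>N\<close> on the jumps smaller than \<open>\<kappa>\<close>.

  The two exponents \<open>t \<psi> (u / sqrt t)\<close> and \<open>- (\<sigma>\<^sub>t)\<^sup>2 u\<^sup>2 / 2\<close> differ by a cubic Taylor remainder on the small
  jumps and by a linear one on the large jumps. Both are controlled by a single quantity, the
  integral \<open>R t\<close> of \<open>y\<^sup>2 min \<bar>y\<bar> (1 / \<bar>y\<bar>)\<close> with respect to \<open>N\<close>
  (\<open>lyapunov_ratio\<close>). Moreover the small jumps and the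
  Gaussian part force Gaussian decay of the characteristic function up to frequencies of order
  \<open>1 / R t\<close>. Esseen's smoothing inequality (\<open>esseen_smoothing\<close>) turns this into a uniform bound
  \<open>K R t\<close> on the distance of the distribution functions
  (\<open>berry_esseen_infinitely_divisible\<close>, \<open>levy_berry_esseen\<close>). The constant \<open>K\<close> does not depend on \<open>t\<close>,
  because \<open>\<sigma>\<^sub>t\<close> is nondecreasing in \<open>t\<close> and \<open>\<sigma>\<^sub>1\<close> is positive by the choice of \<open>\<kappa>\<close>.

  In terms of \<open>\<nu>\<close>, \<open>R t\<close> is the integral of \<open>x\<^sup>2 min (\<bar>x\<bar> / sqrt t) (sqrt t / \<bar>x\<bar>)\<close>. For fixed \<open>x\<close> the
  minimum is integrable against \<open>dt / t\<close>, with a bound that does not depend on \<open>x\<close>, so by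
  Tonelli's theorem \<open>\<integral> R t dt / t\<close> is at most four times \<open>\<integral> x\<^sup>2 \<nu>(dx)\<close>, which is finite
  (\<open>lyapunov_ratio_time_integral\<close>).

  The Bochner integral also asks for measurability of the integrand in \<open>t\<close>. The supremum
  may be taken over the rationals, since distribution functions are right-continuous, and for
  fixed \<open>x\<close> the distribution function is a limit of expectations of continuous functions, which
  depend continuously on \<open>t\<close> by Levy's continuity theorem (\<open>cdf_measurable_in_parameter\<close>).
\<close>

section \<open>The Fejer law\<close>

text \<open>
  This is \<open>(1 - cos z) / (\<pi> z\<^sup>2)\<close>, the density whose characteristic function is the tent
  \<open>max 0 (1 - \<bar>u\<bar>)\<close>; the \<open>sinc\<close> form removes the singularity at zero.
\<close>

definition fejer_density :: "real \<Rightarrow> real" where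
  "fejer_density z = (sinc (z / 2))\<^sup>2 / (2 * pi)"

text \<open>
  Integration by parts of \<open>(1 - cos s) / s\<^sup>2\<close> leaves the sine integral and a boundary term, so the
  known limit of the sine integral gives the total mass.
\<close>

definition fejer_cdf :: "real \<Rightarrow> real" where
  "fejer_cdf z = 1 / 2 + Si z / pi - z * fejer_density z"

text \<open>
  The law is built from its distribution function rather than its density: the smoothing
  argument uses only the distribution function.
\<close>

definition fejer_measure :: "real measure" where
  "fejer_measure = interval_measure fejer_cdf"

lemma fejer_density_nonneg: "0 \<le> fejer_density z"
  by (simp add: fejer_density_def)

lemma fejer_density_eq: "z \<noteq> 0 \<Longrightarrow> fejer_density z = (1 - cos z) / (pi * z\<^sup>2)"
  using cos_double_sin[of "z / 2"]
  by (simp add: fejer_density_def power_divide field_simps)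

lemma isCont_fejer_density: "isCont fejer_density z"
proof -
  have "isCont (\<lambda>z. sinc (z / 2)) z"
    by (rule continuous_within_compose3[OF isCont_sinc]) (auto intro!: continuous_intros)
  then show ?thesis
    unfolding fejer_density_def[abs_def] by (intro continuous_intros) auto
qed

lemma DERIV_fejer_cdf: "(fejer_cdf has_real_derivative fejer_density z) (at z)"
proof (cases "z = 0")
  case True
  have "((\<lambda>z. z * fejer_density z) has_real_derivative fejer_density 0) (at 0)"
    using isCont_fejer_density[of 0]
    by (auto simp: CARAT_DERIV)
  then have "((\<lambda>z. 1 / 2 + Si z / pi - z * fejer_density z)
      has_real_derivative 0 + sinc 0 / pi - fejer_density 0) (at 0)"
    by (intro DERIV_diff DERIV_add DERIV_const DERIV_cdivide DERIV_Si)
  moreover have "0 + sinc 0 / pi - fejer_density 0 = fejer_density 0"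
    by (simp add: fejer_density_def)
  ultimately show ?thesis
    using True by (simp add: fejer_cdf_def[abs_def])
next
  case False
  have ev: "\<forall>\<^sub>F y in nhds z. fejer_cdf y = 1 / 2 + Si y / pi - (1 - cos y) / (pi * y)"
    using t1_space_nhds[OF False]
    by eventually_elim (simp add: fejer_cdf_def fejer_density_eq power2_eq_square)
  have "((\<lambda>y. 1 / 2 + Si y / pi - (1 - cos y) / (pi * y)) has_real_derivative
      0 + sinc z / pi - ((0 + sin z) * (pi * z) - (1 - cos z) * (pi * 1)) / ((pi * z) * (pi * z))) (at z)"
    using False by (auto intro!: derivative_eq_intros DERIV_Si[THEN DERIV_cong])
  moreover have "0 + sinc z / pi - ((0 + sin z) * (pi * z) - (1 - cos z) * (pi * 1)) / ((pi * z) * (pi * z))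
     = fejer_density z"
    using False by (simp add: fejer_density_eq field_simps power2_eq_square)
  ultimately show ?thesis
    using DERIV_cong_ev[OF refl ev refl] by simp
qed

lemma fejer_cdf_minus: "fejer_cdf (- z) = 1 - fejer_cdf z"
proof -
  have "Si (- z) = - Si z"
    using Si_neg[of z] Si_neg[of "- z"] by (cases "0 \<le> z") auto
  then show ?thesis
    by (simp add: fejer_cdf_def fejer_density_def)
qed

lemma fejer_cdf_at_top: "(fejer_cdf \<longlongrightarrow> 1) at_top"
proof -
  have "((\<lambda>z::real. (1 - cos z) / (pi * z)) \<longlongrightarrow> 0) at_top"
  proof (rule Lim_null_comparison)
    show "\<forall>\<^sub>F z in at_top. norm ((1 - cos z) / (pi * z)) \<le> 2 / (pi * z)"
      using eventually_gt_at_top[of 0]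
    proof eventually_elim
      case (elim z)
      have "norm (1 - cos z) \<le> 2"
        using cos_le_one[of z] cos_ge_minus_one[of z] by simp
      then show ?case
        using elim by (simp add: abs_mult divide_right_mono)
    qed
    show "((\<lambda>z. 2 / (pi * z)) \<longlongrightarrow> 0) at_top"
      by real_asymp
  qed
  then have "((\<lambda>z. 1 / 2 + Si z / pi - (1 - cos z) / (pi * z)) \<longlongrightarrow> 1 / 2 + (pi / 2) / pi - 0) at_top"
    by (intro tendsto_intros Si_at_top) auto
  moreover have "\<forall>\<^sub>F z in at_top. 1 / 2 + Si z / pi - (1 - cos z) / (pi * z) = fejer_cdf z"
    using eventually_gt_at_top[of 0]
    by eventually_elim (simp add: fejer_cdf_def fejer_density_eq power2_eq_square)
  ultimately show ?thesis
    by (simp add: tendsto_cong)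
qed

lemma fejer_cdf_at_bot: "(fejer_cdf \<longlongrightarrow> 0) at_bot"
  using tendsto_diff[OF tendsto_const[of 1] fejer_cdf_at_top]
  by (simp add: filterlim_at_bot_mirror fejer_cdf_minus)

lemma isCont_fejer_cdf: "isCont fejer_cdf z"
  using DERIV_fejer_cdf by (rule DERIV_isCont)

lemma fejer_cdf_mono: "x \<le> y \<Longrightarrow> fejer_cdf x \<le> fejer_cdf y"
  using DERIV_nonneg_imp_nondecreasing[of x y fejer_cdf] DERIV_fejer_cdf fejer_density_nonneg
  by blast

lemma real_distribution_fejer: "real_distribution fejer_measure"
  unfolding fejer_measure_def
  by (intro real_distribution_interval_measure fejer_cdf_mono fejer_cdf_at_bot fejer_cdf_at_top
      continuous_at_imp_continuous_within[OF isCont_fejer_cdf])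

lemma cdf_fejer: "cdf fejer_measure = fejer_cdf"
  unfolding fejer_measure_def
  by (intro cdf_interval_measure fejer_cdf_mono fejer_cdf_at_bot
      continuous_at_imp_continuous_within[OF isCont_fejer_cdf])

text \<open>
  Any mass strictly above one half near the origin lets the smoothing argument absorb the
  contribution of the tails; the value \<open>3 / 4\<close> is a convenient choice.
\<close>

lemma fejer_measure_tight: "\<exists>A>0. 3 / 4 \<le> measure fejer_measure {- A..A}"
proof -
  interpret V: real_distribution fejer_measure by (rule real_distribution_fejer)
  have "\<forall>\<^sub>F z in at_top. 7 / 8 < fejer_cdf z"
    using fejer_cdf_at_top by (rule order_tendstoD) simp
  then have "\<forall>\<^sub>F z in at_top. 7 / 8 < fejer_cdf z \<and> 0 < z"
    using eventually_gt_at_top[of 0] by eventually_elim simp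
  then obtain A where A: "7 / 8 < fejer_cdf A" "0 < A"
    using eventually_happens'[of "at_top :: real filter"] by auto
  have "3 / 4 \<le> fejer_cdf A - fejer_cdf (- A)"
    using A by (simp add: fejer_cdf_minus)
  also have "\<dots> = measure fejer_measure {- A<..A}"
    using V.cdf_diff_eq[of "- A" A] A by (simp add: cdf_fejer)
  also have "\<dots> \<le> measure fejer_measure {- A..A}"
    by (intro V.finite_measure_mono) auto
  finally show ?thesis
    using A by auto
qed

text \<open>
  The distribution function at scale \<open>1 / T\<close> is the Fourier transform of a function supported in
  \<open>{0..T}\<close>. This is the property for which the Fejer law is chosen: after smoothing, only the
  frequencies up to \<open>T\<close> are seen. The integrand is \<open>(1 - u / T) * sin (u * z) / u\<close>, extended
  continuously to \<open>u = 0\<close>.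
\<close>

lemma fejer_cdf_fourier:
  assumes T: "0 < T"
  shows "fejer_cdf (T * z) = 1 / 2 + (LBINT u:{0..T}. (1 - u / T) * (z * sinc (u * z))) / pi"
proof -
  have "(LBINT u=0..T. (1 - u / T) * (z * sinc (u * z)))
      = (Si (T * z) - T * z * fejer_density (T * z) * pi)"
  proof (cases "z = 0")
    case True
    then show ?thesis
      using Si_neg[of 0] by simp
  next
    case False
    have Si_0: "Si 0 = 0"
      using Si_neg[of 0] by simp
    let ?F = "\<lambda>u. Si (u * z) + cos (u * z) / (T * z)"
    have "(LBINT u=ereal 0..ereal T. (1 - u / T) * (z * sinc (u * z))) = ?F T - ?F 0"
    proof (rule interval_integral_FTC_finite)
      show "continuous_on {min 0 T..max 0 T} (\<lambda>u. (1 - u / T) * (z * sinc (u * z)))"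
        using T by (intro continuous_intros) auto
      fix u
      have "(?F has_real_derivative (1 - u / T) * (z * sinc (u * z))) (at u)"
      proof -
        have "((\<lambda>u. Si (u * z)) has_real_derivative sinc (u * z) * z) (at u)"
          by (rule DERIV_chain2[OF DERIV_Si]) (auto intro!: derivative_eq_intros)
        moreover have "((\<lambda>u. cos (u * z)) has_real_derivative - sin (u * z) * z) (at u)"
          by (auto intro!: derivative_eq_intros)
        ultimately have "(?F has_real_derivative sinc (u * z) * z + - sin (u * z) * z / (T * z)) (at u)"
          by (intro DERIV_add DERIV_cdivide)
        moreover have "sinc (u * z) * z + - sin (u * z) * z / (T * z) = (1 - u / T) * (z * sinc (u * z))"
          using False T by (simp add: field_simps)
        ultimately show ?thesis by simp
      qed
      then show "(?F has_vector_derivative (1 - u / T) * (z * sinc (u * z)))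
          (at u within {min 0 T..max 0 T})"
        by (simp add: has_real_derivative_iff_has_vector_derivative
            has_vector_derivative_at_within)
    qed
    also have "?F T - ?F 0 = Si (T * z) - T * z * fejer_density (T * z) * pi"
      using False T by (simp add: fejer_density_eq Si_0 field_simps power2_eq_square)
    finally show ?thesis
      by (simp add: zero_ereal_def)
  qed
  also have "(LBINT u=0..T. (1 - u / T) * (z * sinc (u * z)))
      = (LBINT u:{0..T}. (1 - u / T) * (z * sinc (u * z)))"
    using T by (simp add: interval_integral_Icc zero_ereal_def)
  finally show ?thesis
    by (simp add: fejer_cdf_def field_simps)
qed

section \<open>Esseen's smoothing inequality\<close>

text \<open>
  The difference \<open>D\<close> of a distribution function and a Lipschitz one cannot fall fast to the right,
  so a large value \<open>D x0\<close> persists on an interval of length \<open>2 * A / T\<close> starting at \<open>x0\<close>. Averaging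
  around the centre of that interval sees this with weight at least \<open>3 / 4\<close>, and elsewhere loses
  at most \<open>\<eta>\<close>. The sign \<open>e\<close> lets the same argument, applied to \<open>- D\<close> and leftwards,
  treat large negative values.
\<close>

lemma smoothing_one_sided:
  fixes D :: "real \<Rightarrow> real"
  assumes "real_distribution V" and V: "3 / 4 \<le> measure V {- A..A}"
    and [measurable]: "D \<in> borel_measurable borel"
    and e: "e = 1 \<or> e = -1" and T: "0 < T" and A: "0 < A"
    and D: "\<And>y. \<bar>D y\<bar> \<le> \<eta>"
    and growth: "\<And>s. 0 \<le> s \<Longrightarrow> D x0 - m * s \<le> D (x0 + e * s)" and m: "0 \<le> m"
    and smooth: "\<And>x. \<bar>LINT z|V. D (x - z / T)\<bar> \<le> \<theta>"
  shows "3 / 4 * D x0 \<le> \<theta> + 3 / 2 * (m * A / T) + \<eta> / 4"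
proof -
  interpret V: real_distribution V by fact
  define h where "h = A / T"
  have h: "0 < h" using A T by (simp add: h_def)
  have \<eta>: "0 \<le> \<eta>" using D[of 0] by simp
  have \<theta>: "0 \<le> \<theta>" using smooth[of 0] by simp
  \<comment> \<open>The averaged function is at least \<open>c - \<eta>\<close> on the interval and at least \<open>- \<eta>\<close> outside.\<close>
  define c where "c = D x0 - 2 * m * h + \<eta>"
  show ?thesis
  proof (cases "c \<le> 0")
    case True
    then have "D x0 \<le> 2 * (m * h)"
      using \<eta> by (simp add: c_def)
    then have "3 / 4 * D x0 \<le> 3 / 2 * (m * h)"
      by linarith
    then show ?thesis
      using \<eta> \<theta> by (simp add: h_def)
  next
    case False
    let ?x = "x0 + e * h"
    have int: "integrable V (\<lambda>z. D (?x - z / T))"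
      using D by (intro V.integrable_const_bound[of _ \<eta>]) auto
    have "3 / 4 * c - \<eta> \<le> c * measure V {- A..A} - \<eta>"
      using False V by (simp add: mult.commute mult_left_mono)
    also have "\<dots> = (LINT z|V. c * indicator {- A..A} z - \<eta>)"
      using V.prob_space by (simp add: V.emeasure_eq_measure)
    also have "\<dots> \<le> (LINT z|V. D (?x - z / T))"
    proof (rule integral_mono[OF _ int])
      show "integrable V (\<lambda>z. c * indicator {- A..A} z - \<eta>)"
        by (auto simp: V.emeasure_eq_measure)
      fix z
      show "c * indicator {- A..A} z - \<eta> \<le> D (?x - z / T)"
      proof (cases "z \<in> {- A..A}")
        case True
        define s where "s = h - e * z / T"
        have s: "0 \<le> s" "s \<le> 2 * h"
        proof -
          have "e * z \<le> A" "- A \<le> e * z"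
            using True e by auto
          then have "e * z / T \<le> A / T" "- A / T \<le> e * z / T"
            using T by (intro divide_right_mono; simp)+
          then show "0 \<le> s" "s \<le> 2 * h"
            by (simp_all add: s_def h_def)
        qed
        have "c - \<eta> \<le> D x0 - m * s"
          using mult_left_mono[OF s(2) m] by (simp add: c_def mult_ac)
        also have "\<dots> \<le> D (x0 + e * s)"
          using s by (intro growth)
        also have "x0 + e * s = ?x - z / T"
          using e by (auto simp: s_def algebra_simps)
        finally show ?thesis
          using True by simp
      next
        case False
        then show ?thesis
          using D[of "?x - z / T"] by simp
      qed
    qed
    also have "\<dots> \<le> \<theta>"
      using smooth[of ?x] by linarith
    finally show ?thesis
      by (simp add: c_def h_def algebra_simps)
  qed
qed

text \<open>
  Applying the one-sided estimate at every point bounds three quarters of \<open>\<eta>\<close>, the supremum of the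
  difference, by the smoothed difference plus \<open>\<eta> / 4\<close>. Since \<open>\<eta>\<close> is finite, it can be absorbed.
\<close>

lemma smoothing_bound:
  assumes "real_distribution V" and V: "3 / 4 \<le> measure V {- A..A}" and A: "0 < A"
    and "real_distribution \<mu>" and "real_distribution \<gamma>" and T: "0 < T"
    and lip: "\<And>x y. \<bar>cdf \<gamma> x - cdf \<gamma> y\<bar> \<le> m * \<bar>x - y\<bar>"
    and smooth: "\<And>x. \<bar>LINT z|V. cdf \<mu> (x - z / T) - cdf \<gamma> (x - z / T)\<bar> \<le> \<theta>"
  shows "\<bar>cdf \<mu> x - cdf \<gamma> x\<bar> \<le> 2 * \<theta> + 3 * (m * A / T)"
proof -
  interpret \<mu>: real_distribution \<mu> by fact
  interpret \<gamma>: real_distribution \<gamma> by fact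
  define D where "D = (\<lambda>x. cdf \<mu> x - cdf \<gamma> x)"
  have [measurable]: "cdf \<mu> \<in> borel_measurable borel" "cdf \<gamma> \<in> borel_measurable borel"
    by (auto intro!: borel_measurable_mono simp: mono_def \<mu>.cdf_nondecreasing \<gamma>.cdf_nondecreasing)
  have [measurable]: "D \<in> borel_measurable borel"
    by (simp add: D_def)
  have m: "0 \<le> m" using lip[of 1 0] by simp
  define \<eta> where "\<eta> = (SUP x. \<bar>D x\<bar>)"
  have "\<bar>D y\<bar> \<le> 1" for y
    using \<mu>.cdf_nonneg[of y] \<gamma>.cdf_nonneg[of y] \<mu>.cdf_bounded_prob[of y] \<gamma>.cdf_bounded_prob[of y]
    by (auto simp: D_def)
  then have bdd: "bdd_above (range (\<lambda>x. \<bar>D x\<bar>))"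
    by (auto intro!: bdd_aboveI)
  have \<eta>: "\<bar>D y\<bar> \<le> \<eta>" for y
    unfolding \<eta>_def by (rule cSUP_upper[OF _ bdd]) simp
  have smooth_D: "\<bar>LINT z|V. D (x - z / T)\<bar> \<le> \<theta>" for x
    using smooth by (simp add: D_def)
  have "\<bar>D y\<bar> \<le> 4 / 3 * (\<theta> + 3 / 2 * (m * A / T) + \<eta> / 4)" for y
  proof -
    define c where "c = \<theta> + 3 / 2 * (m * A / T) + \<eta> / 4"
    have up: "3 / 4 * D y \<le> \<theta> + 3 / 2 * (m * A / T) + \<eta> / 4"
    proof (rule smoothing_one_sided[OF assms(1) V _ _ T A \<eta>, where e = 1])
      fix s :: real assume s: "0 \<le> s"
      then show "D y - m * s \<le> D (y + 1 * s)"
        using lip[of "y + s" y] \<mu>.cdf_nondecreasing[of y "y + s"] by (simp add: D_def)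
    qed (use smooth_D m in auto)
    have down: "3 / 4 * (- D y) \<le> \<theta> + 3 / 2 * (m * A / T) + \<eta> / 4"
    proof (rule smoothing_one_sided[OF assms(1) V _ _ T A, where e = "-1" and D = "\<lambda>y. - D y"])
      fix s :: real assume s: "0 \<le> s"
      then show "- D y - m * s \<le> - D (y + - 1 * s)"
        using lip[of "y - s" y] \<mu>.cdf_nondecreasing[of "y - s" y] by (simp add: D_def)
    qed (use smooth_D m \<eta> in auto)
    show ?thesis
      using up down unfolding c_def[symmetric] by (intro abs_leI) linarith+
  qed
  then have "\<eta> \<le> 4 / 3 * (\<theta> + 3 / 2 * (m * A / T) + \<eta> / 4)"
    unfolding \<eta>_def by (intro cSUP_least) auto
  then have "\<eta> \<le> 2 * \<theta> + 3 * d" if "m * A / T = d" for d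
    unfolding that by simp
  then have "\<eta> \<le> 2 * \<theta> + 3 * (m * A / T)"
    by blast
  with \<eta>[of x] show ?thesis
    by (simp add: D_def)
qed

text \<open>
  Both sides are the probability that \<open>y + z / T \<le> x\<close> for independent \<open>y\<close> and \<open>z\<close>.
\<close>

lemma cdf_mixture_swap:
  assumes "real_distribution \<mu>" and "real_distribution V" and T: "0 < T"
  shows "(LINT z|V. cdf \<mu> (x - z / T)) = (LINT y|\<mu>. cdf V (T * (x - y)))"
proof -
  interpret \<mu>: real_distribution \<mu> by fact
  interpret V: real_distribution V by fact
  interpret P: pair_prob_space \<mu> V ..
  let ?f = "\<lambda>y z. indicator {p. snd p \<le> T * (x - fst p)} (y, z) :: real"
  have "{p. snd p \<le> T * (x - fst p)} \<in> sets (borel \<Otimes>\<^sub>M borel)"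
    unfolding borel_prod by (intro borel_closed closed_Collect_le continuous_intros)
  then have [measurable]: "{p. snd p \<le> T * (x - fst p)} \<in> sets (\<mu> \<Otimes>\<^sub>M V)"
    by (simp cong: sets_pair_measure_cong)
  have "(LINT z|V. LINT y|\<mu>. ?f y z) = (LINT y|\<mu>. LINT z|V. ?f y z)"
    by (rule P.Fubini_integral) (auto intro!: P.integrable_const_bound[of _ 1] simp: split_beta')
  moreover have "(LINT y|\<mu>. ?f y z) = cdf \<mu> (x - z / T)" for z
  proof -
    have "(\<lambda>y. ?f y z) = indicator {..x - z / T}"
      using T by (auto simp: fun_eq_iff indicator_def field_simps)
    then show ?thesis by (simp add: cdf_def)
  qed
  moreover have "(LINT z|V. ?f y z) = cdf V (T * (x - y))" for y
  proof -
    have "(\<lambda>z. ?f y z) = indicator {..T * (x - y)}"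
      by (auto simp: fun_eq_iff indicator_def)
    then show ?thesis by (simp add: cdf_def)
  qed
  ultimately show ?thesis by simp
qed

lemma (in real_distribution) sinc_transform:
  assumes u: "0 < u"
  shows "(LINT y|M. (x - y) * sinc (u * (x - y))) = - Im (iexp (- u * x) * char M u) / u"
proof -
  have int: "integrable M (\<lambda>y. iexp (u * y))"
    by (intro integrable_const_bound[of _ 1]) auto
  have "(LINT y|M. (x - y) * sinc (u * (x - y)))
      = (LINT y|M. - Im (iexp (- u * x) * iexp (u * y)) / u)"
  proof (rule Bochner_Integration.integral_cong[OF refl])
    fix y
    have "iexp (- u * x) * iexp (u * y) = iexp (- (u * (x - y)))"
      by (simp add: exp_add[symmetric] algebra_simps)
    then show "(x - y) * sinc (u * (x - y)) = - Im (iexp (- u * x) * iexp (u * y)) / u"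
      using u by (simp add: Im_exp)
  qed
  also have "\<dots> = - Im (iexp (- u * x) * char M u) / u"
    using int by (simp add: char_def del: times_complex.sel of_real_mult of_real_minus)
  finally show ?thesis .
qed

text \<open>
  Only the sine part of the Fourier kernel enters, and \<open>sin (u * z) / u\<close> stays bounded by \<open>\<bar>z\<bar>\<close> near
  \<open>u = 0\<close>; the first moment of the law makes this integrable, so that Fubini's theorem applies on all
  of \<open>{0..T}\<close>.
\<close>

lemma (in real_distribution) fejer_smoothing_fourier:
  assumes T: "0 < T" and int: "integrable M (\<lambda>y. y)"
  shows "(LINT z|fejer_measure. cdf M (x - z / T))
    = 1 / 2 - (LBINT u:{0..T}. (1 - u / T) * (Im (iexp (- u * x) * char M u) / u)) / pi" (is ?A)
    and "set_integrable lborel {0..T}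
      (\<lambda>u. (1 - u / T) * (Im (iexp (- u * x) * char M u) / u))" (is ?B)
proof -
  interpret P: pair_sigma_finite lborel M ..
  let ?f = "\<lambda>u y. indicator {0..T} u *\<^sub>R ((1 - u / T) * ((x - y) * sinc (u * (x - y))))"
  have sinc1: "\<bar>sinc z\<bar> \<le> 1" for z
    using abs_sin_le_one[of z] abs_sin_x_le_abs_x[of z] by (auto simp: divide_le_eq)
  have bnd: "norm (?f u y) \<le> indicator {0..T} u * \<bar>x - y\<bar>" for u y
  proof (cases "u \<in> {0..T}")
    case True
    then have "\<bar>1 - u / T\<bar> \<le> 1"
      using T by (auto simp: abs_if field_simps)
    then have "\<bar>1 - u / T\<bar> * (\<bar>x - y\<bar> * \<bar>sinc (u * (x - y))\<bar>) \<le> 1 * (\<bar>x - y\<bar> * 1)"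
      by (intro mult_mono order_refl sinc1) auto
    then show ?thesis
      using True by (simp add: abs_mult del: if_split)
  qed simp
  have [measurable]: "case_prod ?f \<in> borel_measurable (lborel \<Otimes>\<^sub>M M)"
    by (simp add: borel_prod[symmetric] del: if_split) measurable
  have int': "integrable M (\<lambda>y. \<bar>x - y\<bar>)"
    using int by auto
  have dom: "integrable (lborel \<Otimes>\<^sub>M M) (\<lambda>(u, y). indicator {0..T} u * \<bar>x - y\<bar>)"
  proof (rule P.Fubini_integrable)
    show "(\<lambda>(u, y). indicator {0..T} u * \<bar>x - y\<bar>) \<in> borel_measurable (lborel \<Otimes>\<^sub>M M)"
      by measurable
    show "AE u in lborel. integrable M (\<lambda>y. case (u, y) of (u, y) \<Rightarrow> indicator {0..T} u * \<bar>x - y\<bar>)"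
      using int' by simp
    show "integrable lborel (\<lambda>u. LINT y|M. norm (case (u, y) of (u, y) \<Rightarrow> indicator {0..T} u * \<bar>x - y\<bar>))"
      using T by (simp add: abs_mult)
  qed
  have prod: "integrable (lborel \<Otimes>\<^sub>M M) (case_prod ?f)"
    by (rule Bochner_Integration.integrable_bound[OF dom]) (use bnd in \<open>auto simp del: if_split\<close>)
  have inner: "indicator {0..T} u *\<^sub>R ((1 - u / T) * - (Im (iexp (- u * x) * char M u) / u))
     = (LINT y|M. ?f u y)" if "u \<noteq> 0" for u
  proof (cases "u \<in> {0..T}")
    case True
    with that have "0 < u" by simp
    have "(LINT y|M. ?f u y) = (1 - u / T) * (LINT y|M. (x - y) * sinc (u * (x - y)))"
      using True by (simp del: if_split)
    also have "\<dots> = (1 - u / T) * - (Im (iexp (- u * x) * char M u) / u)"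
      by (simp only: sinc_transform[OF \<open>0 < u\<close>] minus_divide_left)
    finally show ?thesis
      using True by simp
  qed simp
  have AE0: "AE u in lborel. u \<noteq> (0::real)"
    by (rule AE_lborel_singleton)
  have meas[measurable]: "(\<lambda>u. (1 - u / T) * (Im (iexp (- u * x) * char M u) / u)) \<in> borel_measurable lborel"
    by measurable
  have I: "integrable lborel (\<lambda>u. LINT y|M. ?f u y)"
    using P.integrable_fst[OF prod] by simp
  have I2: "integrable lborel (\<lambda>u. indicator {0..T} u *\<^sub>R ((1 - u / T) * - (Im (iexp (- u * x) * char M u) / u)))"
    by (rule integrable_cong_AE_imp[OF I]) (use AE0 inner in \<open>auto simp del: if_split\<close>)
  then show ?B
    by (simp add: set_integrable_def)
  have "(LINT z|fejer_measure. cdf M (x - z / T)) = (LINT y|M. fejer_cdf (T * (x - y)))"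
    using cdf_mixture_swap[OF real_distribution_axioms real_distribution_fejer T]
    by (simp add: cdf_fejer)
  also have "\<dots> = (LINT y|M. 1 / 2 + (LINT u|lborel. ?f u y) / pi)"
    by (simp only: fejer_cdf_fourier[OF T] set_lebesgue_integral_def)
  also have "\<dots> = 1 / 2 + (LINT y|M. LINT u|lborel. ?f u y) / pi"
    using P.integrable_snd[OF prod] prob_space by (simp del: if_split)
  also have "(LINT y|M. LINT u|lborel. ?f u y) = (LINT u|lborel. LINT y|M. ?f u y)"
    by (rule P.Fubini_integral[OF prod])
  also have "\<dots> = (LINT u|lborel. indicator {0..T} u *\<^sub>R ((1 - u / T) * - (Im (iexp (- u * x) * char M u) / u)))"
    by (rule integral_cong_AE) (use AE0 inner I in \<open>auto simp del: if_split\<close>)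
  also have "\<dots> = - (LBINT u:{0..T}. (1 - u / T) * (Im (iexp (- u * x) * char M u) / u))"
    by (simp add: set_lebesgue_integral_def)
  finally show ?A by simp
qed

text \<open>
  The first term on the right controls the smoothed difference through the characteristic
  functions, the second is the price of smoothing at scale \<open>1 / T\<close>. The integrand of the classical
  inequality, \<open>cmod (char \<mu> u - char \<gamma> u) / u\<close>, is replaced by an integrable majorant \<open>B\<close>.
\<close>

lemma esseen_smoothing:
  assumes "real_distribution \<mu>" and "real_distribution \<gamma>"
    and int: "integrable \<mu> (\<lambda>y. y)" "integrable \<gamma> (\<lambda>y. y)"
    and lip: "\<And>x y. \<bar>cdf \<gamma> x - cdf \<gamma> y\<bar> \<le> m * \<bar>x - y\<bar>"
    and T: "0 < T"
    and A: "0 < A" "3 / 4 \<le> measure fejer_measure {- A..A}"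
    and B: "set_integrable lborel {0..T} B"
    and diff: "\<And>u. 0 < u \<Longrightarrow> u \<le> T \<Longrightarrow> cmod (char \<mu> u - char \<gamma> u) \<le> u * B u"
  shows "\<bar>cdf \<mu> x - cdf \<gamma> x\<bar> \<le> 2 / pi * (LBINT u:{0..T}. B u) + 3 * (m * A / T)"
proof -
  interpret \<mu>: real_distribution \<mu> by fact
  interpret \<gamma>: real_distribution \<gamma> by fact
  interpret V: real_distribution fejer_measure by (rule real_distribution_fejer)
  have [measurable]: "cdf \<mu> \<in> borel_measurable borel" "cdf \<gamma> \<in> borel_measurable borel"
    by (auto intro!: borel_measurable_mono simp: mono_def \<mu>.cdf_nondecreasing \<gamma>.cdf_nondecreasing)
  have "\<bar>LINT z|fejer_measure. cdf \<mu> (x - z / T) - cdf \<gamma> (x - z / T)\<bar>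
      \<le> (LBINT u:{0..T}. B u) / pi" for x
  proof -
    let ?g = "\<lambda>M u. (1 - u / T) * (Im (iexp (- u * x) * char M u) / u)"
    have bnd: "\<bar>?g \<gamma> u - ?g \<mu> u\<bar> \<le> B u" if u: "u \<in> {0..T}" "u \<noteq> 0" for u
    proof -
      have "?g \<gamma> u - ?g \<mu> u = (1 - u / T) * (Im (iexp (- u * x) * (char \<gamma> u - char \<mu> u)) / u)"
        by (simp add: algebra_simps diff_divide_distrib)
      also have "\<bar>\<dots>\<bar> = \<bar>1 - u / T\<bar> * (\<bar>Im (iexp (- u * x) * (char \<gamma> u - char \<mu> u))\<bar> / u)"
        using u by (simp add: abs_mult)
      also have "\<dots> \<le> 1 * (cmod (iexp (- u * x) * (char \<gamma> u - char \<mu> u)) / u)"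
        using u T by (intro mult_mono divide_right_mono abs_Im_le_cmod) (auto simp: abs_if field_simps)
      also have "\<dots> = cmod (char \<mu> u - char \<gamma> u) / u"
        by (simp add: norm_mult norm_minus_commute)
      also have "\<dots> \<le> B u"
        using diff[of u] u by (simp add: divide_le_eq mult.commute)
      finally show ?thesis .
    qed
    have g_int: "set_integrable lborel {0..T} (?g \<gamma>)" "set_integrable lborel {0..T} (?g \<mu>)"
      by (rule \<gamma>.fejer_smoothing_fourier(2)[OF T int(2)] \<mu>.fejer_smoothing_fourier(2)[OF T int(1)])+
    have d_int: "set_integrable lborel {0..T} (\<lambda>u. ?g \<gamma> u - ?g \<mu> u)"
      using g_int by (rule set_integral_diff(1))
    have "(LINT z|fejer_measure. cdf \<mu> (x - z / T) - cdf \<gamma> (x - z / T))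
        = (LINT z|fejer_measure. cdf \<mu> (x - z / T)) - (LINT z|fejer_measure. cdf \<gamma> (x - z / T))"
      by (intro Bochner_Integration.integral_diff V.integrable_const_bound[of _ 1])
         (auto simp: \<mu>.cdf_nonneg \<mu>.cdf_bounded_prob \<gamma>.cdf_nonneg \<gamma>.cdf_bounded_prob)
    also have "\<dots> = (LBINT u:{0..T}. ?g \<gamma> u) / pi - (LBINT u:{0..T}. ?g \<mu> u) / pi"
      by (simp only: \<mu>.fejer_smoothing_fourier(1)[OF T int(1)] \<gamma>.fejer_smoothing_fourier(1)[OF T int(2)])
    also have "\<dots> = (LBINT u:{0..T}. ?g \<gamma> u - ?g \<mu> u) / pi"
      by (simp only: set_integral_diff(2)[OF g_int] diff_divide_distrib)
    finally have eq: "(LINT z|fejer_measure. cdf \<mu> (x - z / T) - cdf \<gamma> (x - z / T))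
        = (LBINT u:{0..T}. ?g \<gamma> u - ?g \<mu> u) / pi" .
    have "\<bar>LBINT u:{0..T}. ?g \<gamma> u - ?g \<mu> u\<bar> \<le> (LBINT u:{0..T}. B u)"
      unfolding set_lebesgue_integral_def
    proof (rule order_trans[OF integral_abs_bound integral_mono_AE])
      show "integrable lborel (\<lambda>u. \<bar>indicator {0..T} u *\<^sub>R (?g \<gamma> u - ?g \<mu> u)\<bar>)"
        using d_int unfolding set_integrable_def by (rule integrable_abs)
      show "integrable lborel (\<lambda>u. indicator {0..T} u *\<^sub>R B u)"
        using B by (simp add: set_integrable_def)
      show "AE u in lborel. \<bar>indicator {0..T} u *\<^sub>R (?g \<gamma> u - ?g \<mu> u)\<bar> \<le> indicator {0..T} u *\<^sub>R B u"
        using AE_lborel_singleton[of 0]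
      proof eventually_elim
        case (elim u)
        then show ?case
          using bnd[of u] by (simp only: indicator_simps scaleR_one scaleR_zero_left abs_zero order_refl
              split: split_indicator) simp
      qed
    qed
    then show ?thesis
      unfolding eq by (simp add: divide_right_mono)
  qed
  from smoothing_bound[OF real_distribution_fejer A(2,1) assms(1,2) T lip this, of x]
  show ?thesis by (simp add: field_simps)
qed

section \<open>Infinitely divisible laws with finite variance\<close>

text \<open>
  Fatou's lemma applied to \<open>2 n\<^sup>2 (1 - cos (x / n))\<close>, which tends to \<open>x\<^sup>2\<close>. The measure may be infinite: the
  lemma serves Levy measures as well as probability laws.
\<close>

lemma second_moment_from_cosines:
  fixes g :: "nat \<Rightarrow> real"
  assumes N[measurable_cong]: "sets N = sets borel"
    and int: "\<And>n. integrable N (\<lambda>x. 1 - cos (x / real (Suc n)))"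
    and le: "\<forall>\<^sub>F n in sequentially.
      2 * (real (Suc n))\<^sup>2 * (LINT x|N. 1 - cos (x / real (Suc n))) \<le> g n"
    and g: "g \<longlonglongrightarrow> C"
  shows "integrable N (\<lambda>x. x\<^sup>2)" and "(LINT x|N. x\<^sup>2) \<le> C"
proof -
  let ?f = "\<lambda>n x. 2 * (real (Suc n))\<^sup>2 * (1 - cos (x / real (Suc n)))"
  have "\<forall>\<^sub>F n in sequentially. 0 \<le> g n"
    using le
  proof eventually_elim
    case (elim n)
    have "0 \<le> 2 * (real (Suc n))\<^sup>2 * (LINT x|N. 1 - cos (x / real (Suc n)))"
      by (intro mult_nonneg_nonneg) auto
    with elim show ?case by linarith
  qed
  then have C: "0 \<le> C"
    by (intro tendsto_lowerbound[OF g]) auto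
  have lim: "(\<lambda>n. ?f n x) \<longlonglongrightarrow> x\<^sup>2" for x :: real
  proof -
    have "(\<lambda>n. x\<^sup>2 * (sinc (x / 2 * inverse (real (Suc n))))\<^sup>2) \<longlonglongrightarrow> x\<^sup>2 * (sinc (x / 2 * 0))\<^sup>2"
      by (intro tendsto_intros isCont_tendsto_compose[OF isCont_sinc] LIMSEQ_inverse_real_of_nat)
    moreover have "x\<^sup>2 * (sinc (x / 2 * inverse (real (Suc n))))\<^sup>2 = ?f n x" for n
    proof -
      define c where "c = real (Suc n)"
      have c: "c \<noteq> 0" by (simp add: c_def)
      have "cos (x / c) = 1 - 2 * (sin (x / 2 * inverse c))\<^sup>2"
        using cos_double_sin[of "x / 2 * inverse c"] by (simp add: field_simps)
      then have "x\<^sup>2 * (sinc (x / 2 * inverse c))\<^sup>2 = 2 * c\<^sup>2 * (1 - cos (x / c))"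
        using c by (simp add: power_divide power_mult_distrib divide_simps)
      then show ?thesis by (simp only: c_def)
    qed
    ultimately show ?thesis by simp
  qed
  have "(\<integral>\<^sup>+ x. ennreal (x\<^sup>2) \<partial>N) = (\<integral>\<^sup>+ x. liminf (\<lambda>n. ennreal (?f n x)) \<partial>N)"
  proof (rule nn_integral_cong)
    fix x :: real
    have "(\<lambda>n. ennreal (?f n x)) \<longlonglongrightarrow> ennreal (x\<^sup>2)"
      by (intro tendsto_ennrealI lim)
    then show "ennreal (x\<^sup>2) = liminf (\<lambda>n. ennreal (?f n x))"
      by (rule lim_imp_Liminf[OF trivial_limit_sequentially, symmetric])
  qed
  also have "\<dots> \<le> liminf (\<lambda>n. \<integral>\<^sup>+ x. ennreal (?f n x) \<partial>N)"
    by (rule nn_integral_liminf) measurable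
  also have "\<dots> \<le> liminf (\<lambda>n. ennreal (g n))"
  proof (rule Liminf_mono, use le in eventually_elim)
    case (elim n)
    have "(\<integral>\<^sup>+ x. ennreal (?f n x) \<partial>N) = ennreal (LINT x|N. ?f n x)"
      using int[of n] by (intro nn_integral_eq_integral) auto
    also have "\<dots> \<le> ennreal (g n)"
      using elim by (intro ennreal_leI) simp
    finally show ?case .
  qed
  also have "\<dots> = ennreal C"
    using tendsto_ennrealI[OF g] by (simp add: lim_imp_Liminf)
  finally have *: "(\<integral>\<^sup>+ x. ennreal (x\<^sup>2) \<partial>N) \<le> ennreal C" .
  show "integrable N (\<lambda>x. x\<^sup>2)"
  proof (rule integrableI_nonneg)
    show "(\<integral>\<^sup>+ x. ennreal (x\<^sup>2) \<partial>N) < \<infinity>"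
      using le_less_trans[OF * ennreal_less_top] by simp
  qed auto
  then have "ennreal (LINT x|N. x\<^sup>2) \<le> ennreal C"
    using * by (simp add: nn_integral_eq_integral)
  then show "(LINT x|N. x\<^sup>2) \<le> C"
    using C by simp
qed

lemma cmod_iexp_minus_1_linear: "cmod (iexp v - 1 - \<i> * of_real v) \<le> v\<^sup>2 / 2"
  using iexp_approx1[of v 1] by (simp add: numeral_eq_Suc algebra_simps)

text \<open>
  The Levy--Khintchine exponent with the compensator taken over all jumps and no drift, which
  is the exponent of a law with mean zero when \<open>N\<close> has a second moment.
\<close>

definition centred_exponent :: "real \<Rightarrow> real measure \<Rightarrow> real \<Rightarrow> complex" where
  "centred_exponent a N u =
     - of_real (a * u\<^sup>2 / 2) + (CLINT x|N. iexp (u * x) - 1 - \<i> * of_real (u * x))"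

lemma integrable_compensated_iexp:
  assumes [measurable_cong]: "sets N = sets borel" and "integrable N (\<lambda>x::real. x\<^sup>2)"
  shows "integrable N (\<lambda>x. iexp (u * x) - 1 - \<i> * of_real (u * x))"
proof (rule Bochner_Integration.integrable_bound[where f = "\<lambda>x. u\<^sup>2 / 2 * x\<^sup>2"])
  show "AE x in N. cmod (iexp (u * x) - 1 - \<i> * of_real (u * x)) \<le> norm (u\<^sup>2 / 2 * x\<^sup>2)"
    using cmod_iexp_minus_1_linear[of "u * x" for x] by (auto simp: power_mult_distrib simp del: of_real_mult)
qed (use assms in auto)

lemma centred_exponent_bound:
  assumes "sets N = sets borel" and int: "integrable N (\<lambda>x::real. x\<^sup>2)" and a: "0 \<le> a"
  shows "cmod (centred_exponent a N u) \<le> (a + (LINT x|N. x\<^sup>2)) * u\<^sup>2 / 2"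
proof -
  have "cmod (CLINT x|N. iexp (u * x) - 1 - \<i> * of_real (u * x))
      \<le> (LINT x|N. u\<^sup>2 / 2 * x\<^sup>2)"
  proof (rule order_trans[OF integral_norm_bound integral_mono])
    show "integrable N (\<lambda>x. cmod (iexp (u * x) - 1 - \<i> * of_real (u * x)))"
      using integrable_compensated_iexp[OF assms(1,2)] by (rule integrable_norm)
    show "integrable N (\<lambda>x. u\<^sup>2 / 2 * x\<^sup>2)"
      using int by simp
    show "cmod (iexp (u * x) - 1 - \<i> * of_real (u * x)) \<le> u\<^sup>2 / 2 * x\<^sup>2" for x
      using cmod_iexp_minus_1_linear[of "u * x"] by (simp add: power_mult_distrib)
  qed
  then have "cmod (CLINT x|N. iexp (u * x) - 1 - \<i> * of_real (u * x)) \<le> (LINT x|N. x\<^sup>2) * u\<^sup>2 / 2"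
    by (simp add: mult.commute)
  moreover have "cmod (- of_real (a * u\<^sup>2 / 2)) = a * u\<^sup>2 / 2"
    using a by (simp only: norm_minus_cancel norm_of_real) simp
  ultimately show ?thesis
    unfolding centred_exponent_def
    by (intro order_trans[OF norm_triangle_ineq]) (simp add: distrib_right add_divide_distrib)
qed

lemma Re_centred_exponent_nonpos:
  assumes "sets N = sets borel" and "integrable N (\<lambda>x::real. x\<^sup>2)" and "0 \<le> a"
  shows "Re (centred_exponent a N u) \<le> 0"
proof -
  have "Re (CLINT x|N. iexp (u * x) - 1 - \<i> * of_real (u * x)) = (LINT x|N. cos (u * x) - 1)"
    using integral_Re[OF integrable_compensated_iexp[OF assms(1,2), of u]] by (simp add: Re_exp)
  also have "\<dots> \<le> 0"
  proof -
    have "0 \<le> (LINT x|N. - (cos (u * x) - 1))"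
      by (intro Bochner_Integration.integral_nonneg_AE) simp
    then show ?thesis
      unfolding Bochner_Integration.integral_minus by linarith
  qed
  finally show ?thesis
    using mult_nonneg_nonneg[OF assms(3) zero_le_power2[of u]] unfolding centred_exponent_def
    by (simp only: plus_complex.sel uminus_complex.sel Re_complex_of_real)
qed

text \<open>
  The mean value inequality on a half-plane. The factor \<open>exp c\<close> is what transfers the Gaussian decay
  of two characteristic functions to their difference.
\<close>

lemma cmod_exp_diff_le:
  fixes z w :: complex
  assumes "Re z \<le> c" "Re w \<le> c"
  shows "cmod (exp z - exp w) \<le> exp c * cmod (z - w)"
proof (rule field_differentiable_bound)
  show "convex {z. Re z \<le> c}"
    by (rule convex_halfspace_Re_le)
  show "(exp has_field_derivative exp v) (at v within {z. Re z \<le> c})" for v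
    by (rule DERIV_subset[OF DERIV_exp]) simp
  show "cmod (exp v) \<le> exp c" if "v \<in> {z. Re z \<le> c}" for v
    using that by simp
qed (use assms in auto)

lemma (in real_distribution) second_moment_from_char:
  assumes "\<And>u. cmod (char M u - 1) \<le> C * u\<^sup>2 / 2"
  shows "integrable M (\<lambda>x. x\<^sup>2)" and "(LINT x|M. x\<^sup>2) \<le> C"
proof -
  have int: "integrable M (\<lambda>x. 1 - cos (x / real (Suc n)))" for n
    by (intro Bochner_Integration.integrable_diff integrable_const_bound[of _ 1]) auto
  have "2 * (real (Suc n))\<^sup>2 * (LINT x|M. 1 - cos (x / real (Suc n))) \<le> C" for n
  proof -
    let ?u = "1 / real (Suc n)"
    have "(LINT x|M. 1 - cos (x / real (Suc n))) = 1 - Re (char M ?u)"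
    proof -
      have "Re (char M ?u) = (LINT x|M. Re (iexp (?u * x)))"
        unfolding char_def by (intro integral_Re[symmetric] integrable_const_bound[of _ 1]) auto
      then have "Re (char M ?u) = (LINT x|M. cos (x / real (Suc n)))"
        by (simp add: Re_exp)
      moreover have "(LINT x|M. 1 - cos (x / real (Suc n))) = 1 - (LINT x|M. cos (x / real (Suc n)))"
        using prob_space by (subst Bochner_Integration.integral_diff)
          (auto intro!: integrable_const_bound[of _ 1] simp del: space_eq_univ)
      ultimately show ?thesis by simp
    qed
    also have "\<dots> \<le> cmod (char M ?u - 1)"
      using abs_Re_le_cmod[of "char M ?u - 1"] by simp
    also have "\<dots> \<le> C * ?u\<^sup>2 / 2"
      by (rule assms)
    finally have "2 * (real (Suc n))\<^sup>2 * (LINT x|M. 1 - cos (x / real (Suc n)))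
        \<le> 2 * (real (Suc n))\<^sup>2 * (C * ?u\<^sup>2 / 2)"
      by (rule mult_left_mono) simp
    also have "\<dots> = C"
      by (simp add: power_divide)
    finally show ?thesis .
  qed
  from second_moment_from_cosines[OF events_eq_borel int always_eventually[OF allI[OF this]] tendsto_const]
  show "integrable M (\<lambda>x. x\<^sup>2)" and "(LINT x|M. x\<^sup>2) \<le> C" by auto
qed

text \<open>
  The exponent is at most quadratic in modulus and has nonpositive real part, so \<open>char M u - 1\<close> is
  quadratically small.
\<close>

lemma (in real_distribution) second_moment_infinitely_divisible:
  assumes "sets N = sets borel" and "integrable N (\<lambda>x::real. x\<^sup>2)" and "0 \<le> a"
    and char: "\<And>u. char M u = exp (centred_exponent a N u)"
  shows "integrable M (\<lambda>x. x\<^sup>2)" and "(LINT x|M. x\<^sup>2) \<le> a + (LINT x|N. x\<^sup>2)"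
proof -
  have "cmod (char M u - 1) \<le> (a + (LINT x|N. x\<^sup>2)) * u\<^sup>2 / 2" for u
  proof -
    have "cmod (exp (centred_exponent a N u) - exp 0) \<le> exp 0 * cmod (centred_exponent a N u - 0)"
      by (rule cmod_exp_diff_le[OF Re_centred_exponent_nonpos[OF assms(1-3)]]) simp
    then show ?thesis
      using centred_exponent_bound[OF assms(1-3), of u] unfolding char by simp
  qed
  from second_moment_from_char[OF this]
  show "integrable M (\<lambda>x. x\<^sup>2)" and "(LINT x|M. x\<^sup>2) \<le> a + (LINT x|N. x\<^sup>2)" by auto
qed

lemma (in real_distribution) cmod_char_minus_1_le:
  assumes "integrable M (\<lambda>x. x)" and "(LINT x|M. x) = 0" and "integrable M (\<lambda>x. x\<^sup>2)"
  shows "cmod (char M u - 1) \<le> (LINT x|M. x\<^sup>2) * u\<^sup>2 / 2"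
proof -
  have "char M u - 1 = (CLINT x|M. iexp (u * x) - 1 - \<i> * of_real (u * x))"
  proof -
    have i: "integrable M (\<lambda>x. iexp (u * x))"
      by (intro integrable_const_bound[of _ 1]) auto
    have "(CLINT x|M. \<i> * of_real (u * x)) = 0"
      using assms(2) by simp
    moreover have "(CLINT x|M. iexp (u * x) - 1 - \<i> * of_real (u * x))
       = (CLINT x|M. iexp (u * x)) - (CLINT x|M. 1) - (CLINT x|M. \<i> * of_real (u * x))"
      using i assms(1) by (subst Bochner_Integration.integral_diff; simp)+
    ultimately show ?thesis
      using prob_space by (simp add: char_def del: space_eq_univ)
  qed
  also have "cmod \<dots> \<le> (LINT x|M. u\<^sup>2 / 2 * x\<^sup>2)"
  proof (rule order_trans[OF integral_norm_bound integral_mono])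
    show "integrable M (\<lambda>x. cmod (iexp (u * x) - 1 - \<i> * of_real (u * x)))"
      using integrable_compensated_iexp[OF events_eq_borel assms(3)] by (rule integrable_norm)
    show "integrable M (\<lambda>x. u\<^sup>2 / 2 * x\<^sup>2)"
      using assms(3) by simp
    show "cmod (iexp (u * x) - 1 - \<i> * of_real (u * x)) \<le> u\<^sup>2 / 2 * x\<^sup>2" for x
      using cmod_iexp_minus_1_linear[of "u * x"] by (simp add: power_mult_distrib)
  qed
  finally show ?thesis by (simp add: mult.commute)
qed

lemma isCont_centred_exponent:
  assumes N[measurable_cong]: "sets N = sets borel" and int: "integrable N (\<lambda>x::real. x\<^sup>2)"
  shows "isCont (centred_exponent a N) u"
  unfolding continuous_at_sequentially
proof safe
  fix w :: "nat \<Rightarrow> real" assume w: "w \<longlonglongrightarrow> u"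
  then have "Bseq w" by (intro convergent_imp_Bseq convergentI)
  then obtain K where K: "\<And>n. \<bar>w n\<bar> \<le> K" by (auto simp: Bseq_def)
  have "(\<lambda>n. CLINT x|N. iexp (w n * x) - 1 - \<i> * of_real (w n * x))
      \<longlonglongrightarrow> (CLINT x|N. iexp (u * x) - 1 - \<i> * of_real (u * x))"
  proof (rule integral_dominated_convergence[where w = "\<lambda>x. K\<^sup>2 / 2 * x\<^sup>2"])
    show "integrable N (\<lambda>x. K\<^sup>2 / 2 * x\<^sup>2)" using int by simp
    show "AE x in N. (\<lambda>n. iexp (w n * x) - 1 - \<i> * of_real (w n * x))
        \<longlonglongrightarrow> iexp (u * x) - 1 - \<i> * of_real (u * x)"
      by (intro AE_I2 tendsto_intros w)
    show "AE x in N. norm (iexp (w n * x) - 1 - \<i> * of_real (w n * x)) \<le> K\<^sup>2 / 2 * x\<^sup>2" for n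
    proof (rule AE_I2)
      fix x
      have "(w n)\<^sup>2 \<le> K\<^sup>2"
        using power_mono[OF K[of n], of 2] by simp
      then have "(w n * x)\<^sup>2 / 2 \<le> K\<^sup>2 / 2 * x\<^sup>2"
        by (simp add: power_mult_distrib mult_right_mono)
      with cmod_iexp_minus_1_linear[of "w n * x"]
      show "norm (iexp (w n * x) - 1 - \<i> * of_real (w n * x)) \<le> K\<^sup>2 / 2 * x\<^sup>2"
        by (rule order_trans)
    qed
  qed measurable
  then show "(centred_exponent a N \<circ> w) \<longlonglongrightarrow> centred_exponent a N u"
    unfolding centred_exponent_def comp_def by (intro tendsto_intros w) simp_all
qed

lemma integrable_levy_khintchine:
  assumes N: "levy_measure N"
  shows "integrable N (\<lambda>x. iexp (u * x) - 1 - \<i> * of_real (u * x * indicator {-1<..<1} x))"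
proof -
  have [measurable_cong]: "sets N = sets borel"
    using N by (simp add: levy_measure_def)
  have m: "integrable N (\<lambda>x. min 1 (x\<^sup>2))"
    using N by (intro integrableI_nonneg) (auto simp: levy_measure_def)
  show ?thesis
  proof (rule Bochner_Integration.integrable_bound[where f = "\<lambda>x. max 2 (u\<^sup>2 / 2) * min 1 (x\<^sup>2)"])
    show "integrable N (\<lambda>x. max 2 (u\<^sup>2 / 2) * min 1 (x\<^sup>2))"
      using m by simp
    show "AE x in N. cmod (iexp (u * x) - 1 - \<i> * of_real (u * x * indicator {-1<..<1} x))
        \<le> norm (max 2 (u\<^sup>2 / 2) * min 1 (x\<^sup>2))"
    proof (rule AE_I2)
      fix x :: real
      have nn: "norm (max 2 (u\<^sup>2 / 2) * min 1 (x\<^sup>2)) = max 2 (u\<^sup>2 / 2) * min 1 (x\<^sup>2)"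
        by (simp add: abs_mult)
      show "cmod (iexp (u * x) - 1 - \<i> * of_real (u * x * indicator {-1<..<1} x))
          \<le> norm (max 2 (u\<^sup>2 / 2) * min 1 (x\<^sup>2))"
      proof (cases "x \<in> {-1<..<1}")
        case True
        then have "x\<^sup>2 \<le> 1" by (simp add: abs_square_le_1 abs_le_iff)
        have "cmod (iexp (u * x) - 1 - \<i> * of_real (u * x * indicator {-1<..<1} x)) \<le> u\<^sup>2 / 2 * x\<^sup>2"
          using True cmod_iexp_minus_1_linear[of "u * x"] by (simp add: power_mult_distrib)
        also have "\<dots> \<le> max 2 (u\<^sup>2 / 2) * min 1 (x\<^sup>2)"
          using \<open>x\<^sup>2 \<le> 1\<close> by (intro mult_mono) auto
        finally show ?thesis by (simp only: nn)
      next
        case False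
        then have "1 \<le> x\<^sup>2" by (auto simp: power2_ge_1_iff)
        have "cmod (iexp (u * x) - 1 - \<i> * of_real (u * x * indicator {-1<..<1} x)) \<le> cmod (iexp (u * x)) + cmod 1"
          using False norm_triangle_ineq4[of "iexp (u * x)" 1] by simp
        also have "\<dots> \<le> max 2 (u\<^sup>2 / 2) * min 1 (x\<^sup>2)"
          using \<open>1 \<le> x\<^sup>2\<close> by (simp add: min_absorb1)
        finally show ?thesis by (simp only: nn)
      qed
    qed
  qed measurable
qed

lemma levy_khintchine_exponent_centre:
  assumes N: "levy_measure N" and int: "integrable N (\<lambda>x. x\<^sup>2)"
  shows "levy_khintchine_exponent \<gamma> a N u =
    \<i> * of_real ((\<gamma> + (LINT x|N. x * indicator (- {-1<..<1}) x)) * u) + centred_exponent a N u"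
proof -
  have s[measurable_cong]: "sets N = sets borel"
    using N by (simp add: levy_measure_def)
  have i: "integrable N (\<lambda>x. x * indicator (- {-1<..<1}) x)"
  proof (rule Bochner_Integration.integrable_bound[OF int])
    show "AE x in N. norm (x * indicator (- {-1<..<1}) x) \<le> norm (x\<^sup>2)"
    proof (rule AE_I2)
      fix x :: real
      have "\<bar>x\<bar> * 1 \<le> \<bar>x\<bar> * \<bar>x\<bar>" if "1 \<le> \<bar>x\<bar>"
        using that by (intro mult_left_mono) auto
      then show "norm (x * indicator (- {-1<..<1}) x) \<le> norm (x\<^sup>2)"
        by (auto simp: power2_eq_square abs_mult indicator_def)
    qed
  qed measurable
  have "(CLINT x|N. iexp (u * x) - 1 - \<i> * of_real (u * x * indicator {-1<..<1} x))
     = (CLINT x|N. (iexp (u * x) - 1 - \<i> * of_real (u * x))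
          + \<i> * of_real u * of_real (x * indicator (- {-1<..<1}) x))"
    by (intro Bochner_Integration.integral_cong) (auto simp: indicator_def algebra_simps)
  also have "\<dots> = (CLINT x|N. (iexp (u * x) - 1 - \<i> * of_real (u * x)))
          + (CLINT x|N. \<i> * of_real u * of_real (x * indicator (- {-1<..<1}) x))"
    using i by (intro Bochner_Integration.integral_add integrable_compensated_iexp[OF s int]
        integrable_mult_right integrable_of_real)
  also have "(CLINT x|N. \<i> * of_real u * of_real (x * indicator (- {-1<..<1}) x))
      = \<i> * of_real u * of_real (LINT x|N. x * indicator (- {-1<..<1}) x)"
    by (simp only: integral_mult_right_zero integral_complex_of_real)
  finally show ?thesis
    by (simp add: levy_khintchine_exponent_def centred_exponent_def algebra_simps)
qed

text \<open>
  The modulus of the characteristic function sees only the real part of the exponent, and it is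
  at least \<open>1 - v u\<^sup>2 / 2\<close>, where \<open>v\<close> is the variance. So the cosine integrals of \<open>N\<close> are of order \<open>u\<^sup>2\<close>, which
  bounds the second moment of \<open>N\<close> by \<open>v - a\<close>. The exponent is now a drift \<open>\<i> b u\<close> plus the centred
  exponent; since both \<open>char \<mu>\<close> and the exponential of the centred exponent are \<open>1 + O (u\<^sup>2)\<close>, the drift
  vanishes. Then \<open>second_moment_infinitely_divisible\<close> gives the reverse inequality for the variance.
\<close>

lemma levy_measure_second_moment:
  assumes N: "levy_measure N" and a: "0 \<le> a" and "real_distribution \<mu>"
    and char: "\<And>u. char \<mu> u = exp (levy_khintchine_exponent \<gamma> a N u)"
    and \<mu>: "integrable \<mu> (\<lambda>x. x)" "(LINT x|\<mu>. x) = 0" "integrable \<mu> (\<lambda>x. x\<^sup>2)"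
  shows "integrable N (\<lambda>x. x\<^sup>2)" and "a + (LINT x|N. x\<^sup>2) = (LINT x|\<mu>. x\<^sup>2)"
    and "levy_khintchine_exponent \<gamma> a N = centred_exponent a N"
proof -
  interpret \<mu>: real_distribution \<mu> by fact
  have s[measurable_cong]: "sets N = sets borel"
    using N by (simp add: levy_measure_def)
  define v where "v = (LINT x|\<mu>. x\<^sup>2)"
  have v: "0 \<le> v" by (simp add: v_def)
  let ?I = "\<lambda>u. LINT x|N. 1 - cos (u * x)"
  have Re_int: "integrable N (\<lambda>x. 1 - cos (u * x))" for u
    using integrable_minus[OF integrable_Re[OF integrable_levy_khintchine[OF N, of u]]]
    by (simp add: Re_exp)
  have Re_exponent: "Re (levy_khintchine_exponent \<gamma> a N u) = - (a * u\<^sup>2 / 2) - ?I u" for u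
  proof -
    have "Re (CLINT x|N. iexp (u * x) - 1 - \<i> * of_real (u * x * indicator {-1<..<1} x))
        = (LINT x|N. - (1 - cos (u * x)))"
      using integral_Re[OF integrable_levy_khintchine[OF N, of u]] by (simp add: Re_exp)
    then show ?thesis
      by (simp only: levy_khintchine_exponent_def integral_minus) simp
  qed
  have lower: "?I u \<le> - ln (1 - v * u\<^sup>2 / 2) - a * u\<^sup>2 / 2" if u: "v * u\<^sup>2 < 2" for u
  proof -
    have "1 - v * u\<^sup>2 / 2 \<le> cmod (char \<mu> u)"
      using \<mu>.cmod_char_minus_1_le[OF \<mu>, of u] norm_triangle_ineq2[of 1 "1 - char \<mu> u"]
      by (simp add: v_def norm_minus_commute)
    also have "\<dots> = exp (- (a * u\<^sup>2 / 2) - ?I u)"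
      by (simp add: char Re_exponent)
    finally have "ln (1 - v * u\<^sup>2 / 2) \<le> - (a * u\<^sup>2 / 2) - ?I u"
      using u ln_mono[of "1 - v * u\<^sup>2 / 2" "exp (- (a * u\<^sup>2 / 2) - ?I u)"] by simp
    then show ?thesis by simp
  qed
  \<comment> \<open>The factor \<open>2 (n + 1)\<^sup>2\<close> normalizes the cosine integrals at \<open>u = 1 / (n + 1)\<close>.\<close>
  define g where "g n = 2 * (real (Suc n))\<^sup>2 * (- ln (1 - v * (1 / real (Suc n))\<^sup>2 / 2) - a * (1 / real (Suc n))\<^sup>2 / 2)" for n
  obtain k :: nat where k: "v < real k"
    using reals_Archimedean2 by blast
  have ev: "2 * (real (Suc n))\<^sup>2 * (LINT x|N. 1 - cos (x / real (Suc n))) \<le> g n" if n: "k \<le> n" for n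
  proof -
    have "v * 1 < real (Suc n) * real (Suc n)"
      using k n v by (intro le_less_trans[OF _ mult_strict_mono[of v "real (Suc n)" 1 "real (Suc n)"]]) auto
    then have "v * (1 / real (Suc n))\<^sup>2 < 1"
      by (simp add: power_divide power2_eq_square divide_less_eq del: of_nat_Suc)
    then have "?I (1 / real (Suc n)) \<le> - ln (1 - v * (1 / real (Suc n))\<^sup>2 / 2) - a * (1 / real (Suc n))\<^sup>2 / 2"
      by (intro lower) simp
    then have "2 * (real (Suc n))\<^sup>2 * ?I (1 / real (Suc n)) \<le> g n"
      unfolding g_def by (intro mult_left_mono) auto
    then show ?thesis by simp
  qed
  have lim: "g \<longlonglongrightarrow> v - a"
    unfolding g_def by real_asymp
  have "integrable N (\<lambda>x. 1 - cos (x / real (Suc n)))" for n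
    using Re_int[of "1 / real (Suc n)"] by simp
  note moment = second_moment_from_cosines[OF s this eventually_sequentiallyI[of k, OF ev] lim]
  then show int: "integrable N (\<lambda>x. x\<^sup>2)" by simp
  define b where "b = \<gamma> + (LINT x|N. x * indicator (- {-1<..<1}) x)"
  define K where "K = (v + (a + (LINT x|N. x\<^sup>2))) / 2"
  have char_b: "char \<mu> u = iexp (b * u) * exp (centred_exponent a N u)" for u
    by (simp add: char levy_khintchine_exponent_centre[OF N int] b_def exp_add)
  have "\<bar>sin (b * u)\<bar> \<le> K * u\<^sup>2" for u
  proof -
    have "iexp (b * u) - 1 = (char \<mu> u - 1) - iexp (b * u) * (exp (centred_exponent a N u) - exp 0)"
      by (simp add: char_b algebra_simps)
    also have "cmod \<dots> \<le> cmod (char \<mu> u - 1) + cmod (exp (centred_exponent a N u) - exp 0)"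
      by (rule order_trans[OF norm_triangle_ineq4]) (simp add: norm_mult)
    also have "\<dots> \<le> v * u\<^sup>2 / 2 + (a + (LINT x|N. x\<^sup>2)) * u\<^sup>2 / 2"
      using \<mu>.cmod_char_minus_1_le[OF \<mu>, of u] centred_exponent_bound[OF s int a, of u]
        cmod_exp_diff_le[OF Re_centred_exponent_nonpos[OF s int a, of u], of 0]
      by (intro add_mono) (auto simp: v_def)
    also have "\<dots> = K * u\<^sup>2"
      by (simp add: K_def field_simps)
    finally show ?thesis
      using abs_Im_le_cmod[of "iexp (b * u) - 1"] by (simp add: Im_exp)
  qed
  note sin_quad = this
  \<comment> \<open>If \<open>b\<close> were nonzero, \<open>sin (b * u)\<close> would be of order \<open>u\<close>.\<close>
  have sin_le: "norm (real (Suc n) * sin (b * (1 / real (Suc n)))) \<le> K * (1 / real (Suc n))" for n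
  proof -
    define c where "c = real (Suc n)"
    have c: "0 < c" by (simp add: c_def)
    have "c * \<bar>sin (b * (1 / c))\<bar> \<le> c * (K * (1 / c)\<^sup>2)"
      using c sin_quad[of "1 / c"] by (intro mult_left_mono) auto
    also have "\<dots> = K * (1 / c)"
      using c by (simp add: power2_eq_square)
    finally show ?thesis
      using c by (simp add: abs_mult c_def[symmetric] del: of_nat_Suc)
  qed
  have "(\<lambda>n. real (Suc n) * sin (b * (1 / real (Suc n)))) \<longlonglongrightarrow> 0"
  proof (rule Lim_null_comparison[OF always_eventually[OF allI[OF sin_le]]])
    show "(\<lambda>n. K * (1 / real (Suc n))) \<longlonglongrightarrow> 0"
      by real_asymp
  qed
  moreover have "(\<lambda>n. real (Suc n) * sin (b * (1 / real (Suc n)))) \<longlonglongrightarrow> b"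
    by real_asymp
  ultimately have "b = 0"
    using LIMSEQ_unique by blast
  then show exponent: "levy_khintchine_exponent \<gamma> a N = centred_exponent a N"
    by (auto simp: levy_khintchine_exponent_centre[OF N int] b_def)
  have "v \<le> a + (LINT x|N. x\<^sup>2)"
    unfolding v_def using char exponent
    by (intro \<mu>.second_moment_infinitely_divisible(2)[OF s int a]) simp
  then show "a + (LINT x|N. x\<^sup>2) = (LINT x|\<mu>. x\<^sup>2)"
    using moment by (simp add: v_def)
qed

section \<open>Centred Gaussian laws\<close>

lemma cdf_std_normal: "cdf std_normal_distribution x = \<Phi> x"
proof -
  interpret real_distribution std_normal_distribution by (rule real_dist_normal_dist)
  have "cdf std_normal_distribution x = (LINT u|std_normal_distribution. indicator {..x} u)"
    by (simp add: cdf_def)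
  also have "\<dots> = (LINT u|lborel. std_normal_density u * indicator {..x} u)"
    by (subst integral_density) auto
  finally show ?thesis
    by (simp add: std_normal_cdf_def set_lebesgue_integral_def std_normal_density_def mult_ac)
qed

lemma std_normal_cdf_lipschitz: "\<bar>\<Phi> x - \<Phi> y\<bar> \<le> \<bar>x - y\<bar>"
proof -
  interpret real_distribution std_normal_distribution by (rule real_dist_normal_dist)
  have le: "\<Phi> y - \<Phi> x \<le> y - x" if "x < y" for x y
  proof -
    have "\<Phi> y - \<Phi> x = (LINT u|std_normal_distribution. indicator {x<..y} u)"
      using cdf_diff_eq[OF that] by (simp add: cdf_std_normal)
    also have "\<dots> = (LINT u|lborel. std_normal_density u * indicator {x<..y} u)"
      by (subst integral_density) auto
    also have "\<dots> \<le> (LINT u|lborel. indicator {x<..y} u)"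
    proof (rule integral_mono)
      show "integrable lborel (\<lambda>u. std_normal_density u * indicator {x<..y} u)"
        by (intro integrable_mult_indicator[of "{x<..y}" lborel std_normal_density, unfolded real_scaleR_def mult.commute[of "indicator _ _"]]) auto
      fix u
      have "1 / sqrt (2 * pi) \<le> 1"
        using pi_ge_two by (simp add: real_le_rsqrt)
      then have "1 / sqrt (2 * pi) * exp (- u\<^sup>2 / 2) \<le> 1 * 1"
        by (intro mult_mono) auto
      then show "std_normal_density u * indicator {x<..y} u \<le> indicator {x<..y} u"
        by (simp add: std_normal_density_def indicator_def)
    qed (use that in auto)
    finally show ?thesis using that by simp
  qed
  have mono: "\<Phi> x \<le> \<Phi> y" if "x \<le> y" for x y
    using cdf_nondecreasing[OF that] by (simp add: cdf_std_normal)
  show ?thesis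
    using le[of x y] le[of y x] mono[of x y] mono[of y x] by (cases x y rule: linorder_cases) auto
qed

text \<open>
  The Gaussian law is taken as the image of the standard one under scaling, so that its distribution
  function and characteristic function are read off.
\<close>

lemma centred_gaussian:
  assumes s: "0 < s"
  defines "\<gamma> \<equiv> distr std_normal_distribution borel (\<lambda>x. s * x)"
  shows "real_distribution \<gamma>" and "integrable \<gamma> (\<lambda>x. x)" and "cdf \<gamma> x = \<Phi> (x / s)"
    and "char \<gamma> u = exp (- of_real (s\<^sup>2 * u\<^sup>2 / 2))"
proof -
  interpret real_distribution std_normal_distribution by (rule real_dist_normal_dist)
  show "real_distribution \<gamma>"
    unfolding \<gamma>_def by (rule real_distribution_distr) measurable
  show "integrable \<gamma> (\<lambda>x. x)"
    unfolding \<gamma>_def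
  proof (subst integrable_distr_eq)
    show "integrable std_normal_distribution (\<lambda>x. s * x)"
      using integrable_std_normal_distribution_moment[of 1]
      by (intro integrable_mult_right) (simp only: power_one_right)
  qed measurable
  have "(\<lambda>y. s * y) -` {..x} = {..x / s}"
    using s by (auto simp: field_simps)
  then show "cdf \<gamma> x = \<Phi> (x / s)"
    by (simp add: \<gamma>_def cdf_def measure_distr cdf_std_normal[symmetric])
  have "char \<gamma> u = char std_normal_distribution (s * u)"
    by (simp add: \<gamma>_def char_def integral_distr mult_ac)
  then show "char \<gamma> u = exp (- of_real (s\<^sup>2 * u\<^sup>2 / 2))"
    by (simp add: char_std_normal_distribution power_mult_distrib exp_of_real[symmetric])
qed

section \<open>A Berry--Esseen bound for infinitely divisible laws\<close>

text \<open>
  The function \<open>min \<bar>x\<bar> (1 / \<bar>x\<bar>)\<close> changes its form at \<open>1\<close> whereas jumps are truncated at \<open>\<kappa>\<close>; on the range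
  between the two, \<open>\<bar>x\<bar>\<close> and \<open>1 / \<bar>x\<bar>\<close> differ at most by the factor \<open>\<kappa>\<^sup>2\<close>.
\<close>

lemma min_abs_inverse_lower:
  fixes x :: real
  assumes "1 \<le> \<kappa>"
  shows "\<bar>x\<bar> < \<kappa> \<Longrightarrow> \<bar>x\<bar> \<le> \<kappa>\<^sup>2 * min \<bar>x\<bar> (1 / \<bar>x\<bar>)"
    and "\<kappa> \<le> \<bar>x\<bar> \<Longrightarrow> 1 / \<bar>x\<bar> \<le> \<kappa>\<^sup>2 * min \<bar>x\<bar> (1 / \<bar>x\<bar>)"
proof -
  have \<kappa>: "1 \<le> \<kappa>\<^sup>2" using assms by simp
  have \<kappa>': "y \<le> \<kappa>\<^sup>2 * y" if "0 \<le> y" for y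
    using mult_right_mono[OF \<kappa> that] by simp
  show "\<bar>x\<bar> \<le> \<kappa>\<^sup>2 * min \<bar>x\<bar> (1 / \<bar>x\<bar>)" if x: "\<bar>x\<bar> < \<kappa>"
  proof (cases "x = 0")
    case False
    have "\<bar>x\<bar> * \<bar>x\<bar> \<le> \<kappa> * \<kappa>"
      using x by (intro mult_mono) auto
    then have "\<bar>x\<bar> \<le> \<kappa>\<^sup>2 * (1 / \<bar>x\<bar>)"
      using False by (simp add: field_simps power2_eq_square)
    then show ?thesis
      using \<kappa>'[of "\<bar>x\<bar>"] by (simp add: min_def)
  qed simp
  show "1 / \<bar>x\<bar> \<le> \<kappa>\<^sup>2 * min \<bar>x\<bar> (1 / \<bar>x\<bar>)" if x: "\<kappa> \<le> \<bar>x\<bar>"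
  proof -
    have "1 \<le> \<bar>x\<bar>" using x assms by simp
    then have "1 / \<bar>x\<bar> \<le> \<bar>x\<bar>"
      using mult_mono[of 1 "\<bar>x\<bar>" 1 "\<bar>x\<bar>"] by (simp add: divide_le_eq)
    then show ?thesis
      using \<kappa>'[of "1 / \<bar>x\<bar>"] by (simp add: min_absorb2)
  qed
qed

text \<open>
  Small jumps leave a third order Taylor remainder after the quadratic term is removed. Large jumps
  are not compensated quadratically and contribute at most \<open>2 * \<bar>u * x\<bar>\<close>. To the real part they
  contribute with a favourable sign, so the linear term \<open>2 * u\<close> is absent from the second estimate. For
  small \<open>u\<close> a linear term could not be absorbed by the quadratic Gaussian exponent.
\<close>

lemma compensated_iexp_truncated:
  fixes u x :: real
  assumes \<kappa>: "1 \<le> \<kappa>" and u: "0 \<le> u"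
  defines "w \<equiv> x\<^sup>2 * min \<bar>x\<bar> (1 / \<bar>x\<bar>)"
    and "q \<equiv> u\<^sup>2 / 2 * (indicator {- \<kappa><..<\<kappa>} x * x\<^sup>2)"
  shows "cmod (iexp (u * x) - 1 - \<i> * of_real (u * x) + of_real q) \<le> \<kappa>\<^sup>2 * (2 * u + u^3 / 6) * w"
    and "cos (u * x) - 1 + q \<le> \<kappa>\<^sup>2 * (u^3 / 6) * w"
proof -
  have w: "0 \<le> w" by (simp add: w_def)
  have *: "cmod (iexp (u * x) - 1 - \<i> * of_real (u * x) + of_real q) \<le> \<kappa>\<^sup>2 * (u^3 / 6) * w"
    if x: "\<bar>x\<bar> < \<kappa>"
  proof -
    have "iexp (u * x) - 1 - \<i> * of_real (u * x) + of_real q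
        = iexp (u * x) - (\<Sum>k\<le>2. (\<i> * of_real (u * x)) ^ k / fact k)"
      using x by (simp add: q_def numeral_2_eq_2 abs_less_iff power_mult_distrib)
    moreover have "Suc 2 = 3" "fact 3 = (6 :: real)"
      by (simp_all add: fact_numeral)
    ultimately have "cmod (iexp (u * x) - 1 - \<i> * of_real (u * x) + of_real q) \<le> \<bar>u * x\<bar> ^ 3 / 6"
      using iexp_approx1[of "u * x" 2] by (simp only:)
    also have "\<dots> = u^3 / 6 * x\<^sup>2 * \<bar>x\<bar>"
      using u by (simp add: abs_mult power_mult_distrib power3_eq_cube power2_eq_square)
    also have "\<dots> \<le> u^3 / 6 * x\<^sup>2 * (\<kappa>\<^sup>2 * min \<bar>x\<bar> (1 / \<bar>x\<bar>))"
      using u by (intro mult_left_mono min_abs_inverse_lower(1)[OF \<kappa> x]) auto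
    finally show ?thesis by (simp add: w_def mult_ac)
  qed
  show "cmod (iexp (u * x) - 1 - \<i> * of_real (u * x) + of_real q) \<le> \<kappa>\<^sup>2 * (2 * u + u^3 / 6) * w"
  proof (cases "\<bar>x\<bar> < \<kappa>")
    case True
    have "\<kappa>\<^sup>2 * (u^3 / 6) * w \<le> \<kappa>\<^sup>2 * (2 * u + u^3 / 6) * w"
      using u w by (intro mult_mono) auto
    with *[OF True] show ?thesis by simp
  next
    case False
    then have x: "\<kappa> \<le> \<bar>x\<bar>" by simp
    with \<kappa> have "x \<noteq> 0" by auto
    have "q = 0" using False by (auto simp: q_def indicator_def)
    then have "cmod (iexp (u * x) - 1 - \<i> * of_real (u * x) + of_real q) \<le> 2 * \<bar>u * x\<bar>"
      using iexp_approx2[of "u * x" 1] by (simp add: algebra_simps)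
    also have "\<dots> = 2 * u * x\<^sup>2 * (1 / \<bar>x\<bar>)"
      using u \<open>x \<noteq> 0\<close> by (simp add: abs_mult power2_eq_square eq_divide_eq mult.assoc)
    also have "\<dots> \<le> 2 * u * x\<^sup>2 * (\<kappa>\<^sup>2 * min \<bar>x\<bar> (1 / \<bar>x\<bar>))"
      using u by (intro mult_left_mono min_abs_inverse_lower(2)[OF \<kappa> x]) auto
    also have "\<dots> = \<kappa>\<^sup>2 * (2 * u) * w"
      by (simp add: w_def mult_ac)
    also have "\<dots> \<le> \<kappa>\<^sup>2 * (2 * u + u^3 / 6) * w"
      using u w by (intro mult_mono) auto
    finally show ?thesis .
  qed
  show "cos (u * x) - 1 + q \<le> \<kappa>\<^sup>2 * (u^3 / 6) * w"
  proof (cases "\<bar>x\<bar> < \<kappa>")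
    case True
    have "cos (u * x) - 1 + q \<le> cmod (iexp (u * x) - 1 - \<i> * of_real (u * x) + of_real q)"
      using complex_Re_le_cmod[of "iexp (u * x) - 1 - \<i> * of_real (u * x) + of_real q"]
      by (simp add: Re_exp)
    with *[OF True] show ?thesis by simp
  next
    case False
    then have "q = 0" by (auto simp: q_def indicator_def)
    moreover have "0 \<le> \<kappa>\<^sup>2 * (u^3 / 6) * w" using u w by simp
    ultimately show ?thesis using cos_le_one[of "u * x"] by linarith
  qed
qed

lemma integrable_truncated_third_moment:
  assumes [measurable_cong]: "sets N = sets borel" and int: "integrable N (\<lambda>x::real. x\<^sup>2)"
  shows "integrable N (\<lambda>x. x\<^sup>2 * min \<bar>x\<bar> (1 / \<bar>x\<bar>))"
proof (rule Bochner_Integration.integrable_bound[OF int])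
  show "AE x in N. norm (x\<^sup>2 * min \<bar>x\<bar> (1 / \<bar>x\<bar>)) \<le> norm (x\<^sup>2)"
  proof (rule AE_I2)
    fix x :: real
    have "min \<bar>x\<bar> (1 / \<bar>x\<bar>) \<le> 1"
      by (cases "\<bar>x\<bar> \<le> 1") (auto simp: min_le_iff_disj divide_le_eq)
    then show "norm (x\<^sup>2 * min \<bar>x\<bar> (1 / \<bar>x\<bar>)) \<le> norm (x\<^sup>2)"
      by (simp add: abs_mult mult_left_le)
  qed
qed measurable

lemma centred_exponent_near_gaussian:
  fixes a :: real
  assumes N: "sets N = sets borel" and int: "integrable N (\<lambda>x::real. x\<^sup>2)"
    and \<kappa>: "1 \<le> \<kappa>" and u: "0 \<le> u"
  defines "v \<equiv> a + (LINT x:{- \<kappa><..<\<kappa>}|N. x\<^sup>2)"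
    and "R \<equiv> (LINT x|N. x\<^sup>2 * min \<bar>x\<bar> (1 / \<bar>x\<bar>))"
  shows "cmod (centred_exponent a N u + of_real (v * u\<^sup>2 / 2)) \<le> \<kappa>\<^sup>2 * (2 * u + u^3 / 6) * R"
    and "Re (centred_exponent a N u) \<le> - (v * u\<^sup>2 / 2) + \<kappa>\<^sup>2 * (u^3 / 6) * R"
proof -
  note [measurable_cong] = N
  let ?q = "\<lambda>x. u\<^sup>2 / 2 * (indicator {- \<kappa><..<\<kappa>} x * x\<^sup>2)"
  let ?g = "\<lambda>x. iexp (u * x) - 1 - \<i> * of_real (u * x)"
  have q_int: "integrable N ?q"
    using integrable_mult_indicator[OF _ int, of "{- \<kappa><..<\<kappa>}"] by simp
  have g_int: "integrable N ?g"
    by (rule integrable_compensated_iexp[OF N int])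
  have w_int: "integrable N (\<lambda>x. c * (x\<^sup>2 * min \<bar>x\<bar> (1 / \<bar>x\<bar>)))" for c
    using integrable_truncated_third_moment[OF N int] by simp
  have v: "v * u\<^sup>2 / 2 = a * u\<^sup>2 / 2 + (LINT x|N. ?q x)"
  proof -
    have "(LINT x|N. ?q x) = u\<^sup>2 / 2 * (LINT x|N. indicator {- \<kappa><..<\<kappa>} x * x\<^sup>2)"
      by (rule integral_mult_right_zero)
    then show ?thesis
      by (simp only: v_def set_lebesgue_integral_def real_scaleR_def) (simp add: algebra_simps)
  qed
  have "centred_exponent a N u + of_real (v * u\<^sup>2 / 2) = (CLINT x|N. ?g x) + (CLINT x|N. of_real (?q x))"
    unfolding v centred_exponent_def integral_complex_of_real by simp
  also have "\<dots> = (CLINT x|N. ?g x + of_real (?q x))"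
    using g_int q_int by (intro Bochner_Integration.integral_add[symmetric] integrable_of_real)
  finally have eq: "centred_exponent a N u + of_real (v * u\<^sup>2 / 2) = (CLINT x|N. ?g x + of_real (?q x))" .
  have gq_int: "integrable N (\<lambda>x. ?g x + of_real (?q x))"
    using g_int q_int by (intro Bochner_Integration.integrable_add integrable_of_real)
  have "cmod (CLINT x|N. ?g x + of_real (?q x)) \<le> (LINT x|N. \<kappa>\<^sup>2 * (2 * u + u^3 / 6) * (x\<^sup>2 * min \<bar>x\<bar> (1 / \<bar>x\<bar>)))"
    by (rule order_trans[OF integral_norm_bound integral_mono[OF integrable_norm[OF gq_int] w_int
          compensated_iexp_truncated(1)[OF \<kappa> u]]])
  then show "cmod (centred_exponent a N u + of_real (v * u\<^sup>2 / 2)) \<le> \<kappa>\<^sup>2 * (2 * u + u^3 / 6) * R"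
    unfolding eq R_def by simp
  have "Re (centred_exponent a N u + of_real (v * u\<^sup>2 / 2)) = (LINT x|N. Re (?g x + of_real (?q x)))"
    unfolding eq by (rule integral_Re[OF gq_int, symmetric])
  also have "\<dots> \<le> (LINT x|N. \<kappa>\<^sup>2 * (u^3 / 6) * (x\<^sup>2 * min \<bar>x\<bar> (1 / \<bar>x\<bar>)))"
  proof (rule integral_mono[OF integrable_Re[OF gq_int] w_int])
    show "Re (?g x + of_real (?q x)) \<le> \<kappa>\<^sup>2 * (u^3 / 6) * (x\<^sup>2 * min \<bar>x\<bar> (1 / \<bar>x\<bar>))" for x
      using compensated_iexp_truncated(2)[OF \<kappa> u, of x] by (simp add: Re_exp)
  qed
  also have "\<dots> = \<kappa>\<^sup>2 * (u^3 / 6) * R"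
    by (simp add: R_def)
  finally show "Re (centred_exponent a N u) \<le> - (v * u\<^sup>2 / 2) + \<kappa>\<^sup>2 * (u^3 / 6) * R"
    by (simp only: plus_complex.sel Re_complex_of_real)
qed

lemma integrable_gaussian_weight:
  assumes "0 < c"
  shows "integrable lborel (\<lambda>u. (2 + u\<^sup>2 / 6) * exp (- (c\<^sup>2 * u\<^sup>2 / 4)) :: real)"
proof -
  define \<tau> where "\<tau> = sqrt 2 / c"
  have \<tau>: "0 < \<tau>" using assms by (simp add: \<tau>_def)
  have nd: "exp (- (c\<^sup>2 * u\<^sup>2 / 4)) = sqrt (2 * pi * \<tau>\<^sup>2) * normal_density 0 \<tau> u" for u
  proof -
    have "- (u\<^sup>2) / (2 * \<tau>\<^sup>2) = - (c\<^sup>2 * u\<^sup>2 / 4)"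
      using assms by (simp add: \<tau>_def power_divide field_simps)
    then show ?thesis
      using \<tau> by (simp add: normal_density_def)
  qed
  have "integrable lborel (\<lambda>u. sqrt (2 * pi * \<tau>\<^sup>2) * (2 * normal_density 0 \<tau> u + (normal_density 0 \<tau> u * (u - 0)^2) / 6))"
    by (intro integrable_mult_right Bochner_Integration.integrable_add integrable_divide
        integrable_normal_moment[OF \<tau>] integrable_normal_density[OF \<tau>])
  then show ?thesis
    unfolding nd by (simp add: algebra_simps)
qed

text \<open>
  The two summands are the two terms of Esseen's inequality: the integral over all frequencies of
  the Gaussian majorant, and the cost of the frequency cutoff \<open>3 * c\<^sup>2 / (2 * \<kappa>\<^sup>2 * r)\<close>, each divided by the
  bound \<open>r\<close> on the truncated third moment.
\<close>

definition berry_esseen_const :: "real \<Rightarrow> real \<Rightarrow> real \<Rightarrow> real" where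
  "berry_esseen_const A \<kappa> c =
     2 / pi * \<kappa>\<^sup>2 * (LINT u|lborel. (2 + u\<^sup>2 / 6) * exp (- (c\<^sup>2 * u\<^sup>2 / 4))) + 2 * A * \<kappa>\<^sup>2 / c^3"

lemma berry_esseen_const_nonneg:
  assumes "0 \<le> A" and "0 < c"
  shows "0 \<le> berry_esseen_const A \<kappa> c"
  unfolding berry_esseen_const_def using assms
  by (intro add_nonneg_nonneg mult_nonneg_nonneg Bochner_Integration.integral_nonneg_AE) auto

text \<open>
  Up to the frequency \<open>T\<close> the cubic remainder uses at most half of the Gaussian exponent, so both
  characteristic functions, and hence their difference, decay like \<open>exp (- c\<^sup>2 u\<^sup>2 / 4)\<close>. The number \<open>r\<close> is an upper
  bound rather than the integral itself because \<open>T\<close> is proportional to \<open>1 / r\<close> and must be finite.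
\<close>

lemma berry_esseen_infinitely_divisible:
  assumes "real_distribution \<mu>"
    and char: "\<And>u. char \<mu> u = exp (centred_exponent a N u)"
    and N: "sets N = sets borel" "integrable N (\<lambda>x::real. x\<^sup>2)" and a: "0 \<le> a"
    and \<kappa>: "1 \<le> \<kappa>" and c: "0 < c"
    and A: "0 < A" "3 / 4 \<le> measure fejer_measure {- A..A}"
    and v: "v = a + (LINT x:{- \<kappa><..<\<kappa>}|N. x\<^sup>2)" "c\<^sup>2 \<le> v"
    and r: "(LINT x|N. x\<^sup>2 * min \<bar>x\<bar> (1 / \<bar>x\<bar>)) \<le> r" "0 < r"
  shows "\<bar>cdf \<mu> x - \<Phi> (x / sqrt v)\<bar> \<le> berry_esseen_const A \<kappa> c * r"
proof -
  interpret \<mu>: real_distribution \<mu> by fact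
  define R where "R = (LINT x|N. x\<^sup>2 * min \<bar>x\<bar> (1 / \<bar>x\<bar>))"
  have R: "0 \<le> R" "R \<le> r"
    using r by (auto simp: R_def)
  have c2: "0 < c\<^sup>2" using c by simp
  then have v_pos: "0 < v" using v(2) by linarith
  define s where "s = sqrt v"
  have s: "0 < s" "s\<^sup>2 = v" "c \<le> s"
    using v_pos v(2) c by (auto simp: s_def intro: real_le_rsqrt)
  define \<gamma> where "\<gamma> = distr std_normal_distribution borel (\<lambda>x. s * x)"
  note \<gamma> = centred_gaussian[OF s(1), folded \<gamma>_def]
  \<comment> \<open>The choice makes \<open>\<kappa>\<^sup>2 * (u ^ 3 / 6) * r \<le> c\<^sup>2 * u\<^sup>2 / 4\<close> hold exactly up to \<open>u = T\<close>.\<close>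
  define T where "T = 3 * c\<^sup>2 / (2 * \<kappa>\<^sup>2 * r)"
  have T: "0 < T" using c2 \<kappa> r by (simp add: T_def)
  define h where "h u = (2 + u\<^sup>2 / 6) * exp (- (c\<^sup>2 * u\<^sup>2 / 4))" for u :: real
  have h_int: "integrable lborel h"
    using integrable_gaussian_weight[OF c] by (simp add: h_def[abs_def])
  have h_nonneg: "0 \<le> h u" for u by (simp add: h_def)
  define B where "B u = \<kappa>\<^sup>2 * r * h u" for u
  have B_int: "integrable lborel B"
    using h_int by (simp add: B_def[abs_def])
  have "\<bar>cdf \<mu> x - cdf \<gamma> x\<bar> \<le> 2 / pi * (LBINT u:{0..T}. B u) + 3 * (1 / c * A / T)"
  proof (rule esseen_smoothing[OF assms(1) \<gamma>(1) _ \<gamma>(2) _ T A])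
    have "integrable \<mu> (\<lambda>x. x\<^sup>2)"
      by (rule \<mu>.second_moment_infinitely_divisible(1)[OF N a char])
    then show "integrable \<mu> (\<lambda>x. x)"
      by (rule \<mu>.square_integrable_imp_integrable[rotated]) simp
    show "\<bar>cdf \<gamma> x - cdf \<gamma> y\<bar> \<le> 1 / c * \<bar>x - y\<bar>" for x y
    proof -
      have "\<bar>cdf \<gamma> x - cdf \<gamma> y\<bar> \<le> \<bar>x / s - y / s\<bar>"
        unfolding \<gamma>(3) by (rule std_normal_cdf_lipschitz)
      also have "\<dots> = 1 / s * \<bar>x - y\<bar>"
        using s by (simp add: diff_divide_distrib[symmetric])
      also have "\<dots> \<le> 1 / c * \<bar>x - y\<bar>"
        using s c by (intro mult_right_mono divide_left_mono) auto
      finally show ?thesis .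
    qed
    show "set_integrable lborel {0..T} B"
      using integrable_mult_indicator[OF _ B_int, of "{0..T}"] by (simp add: set_integrable_def)
    fix u assume u: "0 < u" "u \<le> T"
    have u0: "0 \<le> u" using u by simp
    note near = centred_exponent_near_gaussian[OF N \<kappa> u0, of a, folded v(1) R_def]
    have cv: "c\<^sup>2 * u\<^sup>2 \<le> v * u\<^sup>2"
      using v(2) by (intro mult_right_mono) auto
    have "\<kappa>\<^sup>2 * (u^3 / 6) * R \<le> \<kappa>\<^sup>2 * (u\<^sup>2 * T / 6) * r"
      using R u by (intro mult_mono mult_nonneg_nonneg) (auto simp: power3_eq_cube power2_eq_square)
    also have "\<dots> = c\<^sup>2 * u\<^sup>2 / 4"
      using \<kappa> r by (simp add: T_def field_simps)
    finally have "Re (centred_exponent a N u) \<le> - (c\<^sup>2 * u\<^sup>2 / 4)"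
      using near(2) cv by linarith
    moreover have "Re (- of_real (v * u\<^sup>2 / 2)) \<le> - (c\<^sup>2 * u\<^sup>2 / 4)"
    proof -
      have "0 \<le> c\<^sup>2 * u\<^sup>2" by simp
      then have "- (v * u\<^sup>2 / 2) \<le> - (c\<^sup>2 * u\<^sup>2 / 4)"
        using cv by linarith
      then show ?thesis
        by (simp only: uminus_complex.sel Re_complex_of_real)
    qed
    ultimately have "cmod (char \<mu> u - char \<gamma> u)
        \<le> exp (- (c\<^sup>2 * u\<^sup>2 / 4)) * cmod (centred_exponent a N u - - of_real (v * u\<^sup>2 / 2))"
      unfolding char \<gamma>(4) s(2) by (rule cmod_exp_diff_le)
    also have "\<dots> \<le> exp (- (c\<^sup>2 * u\<^sup>2 / 4)) * (\<kappa>\<^sup>2 * (2 * u + u^3 / 6) * r)"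
    proof (rule mult_left_mono)
      have "\<kappa>\<^sup>2 * (2 * u + u^3 / 6) * R \<le> \<kappa>\<^sup>2 * (2 * u + u^3 / 6) * r"
        using R u by (intro mult_left_mono) auto
      then show "cmod (centred_exponent a N u - - of_real (v * u\<^sup>2 / 2)) \<le> \<kappa>\<^sup>2 * (2 * u + u^3 / 6) * r"
        using near(1) by simp
    qed simp
    also have "\<dots> = u * B u"
      by (simp add: B_def h_def algebra_simps power3_eq_cube power2_eq_square)
    finally show "cmod (char \<mu> u - char \<gamma> u) \<le> u * B u" .
  qed
  also have "\<dots> \<le> 2 / pi * (LINT u|lborel. B u) + 3 * (1 / c * A / T)"
  proof (intro add_right_mono mult_left_mono)
    show "(LBINT u:{0..T}. B u) \<le> (LINT u|lborel. B u)"
      unfolding set_lebesgue_integral_def using r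
      by (intro integral_mono B_int integrable_mult_indicator) (auto simp: B_def h_nonneg indicator_def)
  qed simp
  also have "2 / pi * (LINT u|lborel. B u) + 3 * (1 / c * A / T) = berry_esseen_const A \<kappa> c * r"
  proof -
    have "(LINT u|lborel. B u) = \<kappa>\<^sup>2 * r * (LINT u|lborel. h u)"
      unfolding B_def by (rule integral_mult_right_zero)
    moreover have "3 * (1 / c * A / T) = 2 * A * \<kappa>\<^sup>2 / c^3 * r"
      using c \<kappa> r by (simp add: T_def field_simps power3_eq_cube power2_eq_square)
    moreover have "berry_esseen_const A \<kappa> c = 2 / pi * \<kappa>\<^sup>2 * (LINT u|lborel. h u) + 2 * A * \<kappa>\<^sup>2 / c^3"
      by (simp add: berry_esseen_const_def h_def)
    ultimately show ?thesis
      by (simp only:) (simp add: algebra_simps)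
  qed
  finally show ?thesis
    by (simp add: \<gamma>(3) s_def)
qed

section \<open>Diffusive rescaling and integration over time\<close>

text \<open>
  If \<open>N\<close> is the Levy measure of a Levy process \<open>X\<close>, this is the Levy measure of \<open>X t / sqrt t\<close>. The
  diffusive scaling leaves the second moment and the Gaussian variance unchanged.
\<close>

definition scaled_levy_measure :: "real measure \<Rightarrow> real \<Rightarrow> real measure" where
  "scaled_levy_measure N t = density (distr N borel (\<lambda>x. x / sqrt t)) (\<lambda>_. ennreal t)"

lemma sets_scaled_levy_measure: "sets (scaled_levy_measure N t) = sets borel"
  by (simp add: scaled_levy_measure_def)

lemma scaled_levy_measure_integral:
  fixes f :: "real \<Rightarrow> 'b :: {banach, second_countable_topology}"
  assumes [measurable_cong]: "sets N = sets borel" and [measurable]: "f \<in> borel_measurable borel"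
    and t: "0 < t"
  shows "(LINT y|scaled_levy_measure N t. f y) = t *\<^sub>R (LINT x|N. f (x / sqrt t))"
    and "integrable (scaled_levy_measure N t) f \<longleftrightarrow> integrable N (\<lambda>x. f (x / sqrt t))"
proof -
  show "(LINT y|scaled_levy_measure N t. f y) = t *\<^sub>R (LINT x|N. f (x / sqrt t))"
    unfolding scaled_levy_measure_def using t
    by (subst integral_density) (auto simp: integral_distr)
  show "integrable (scaled_levy_measure N t) f \<longleftrightarrow> integrable N (\<lambda>x. f (x / sqrt t))"
  proof -
    have "integrable (scaled_levy_measure N t) f \<longleftrightarrow> integrable N (\<lambda>x. t *\<^sub>R f (x / sqrt t))"
      unfolding scaled_levy_measure_def using t
      by (subst integrable_density) (auto simp: integrable_distr_eq)
    also have "\<dots> \<longleftrightarrow> integrable N (\<lambda>x. f (x / sqrt t))"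
      using t integrable_scaleR_right[of "1 / t" N "\<lambda>x. t *\<^sub>R f (x / sqrt t)"]
        integrable_scaleR_right[of t N "\<lambda>x. f (x / sqrt t)"] by auto
    finally show ?thesis .
  qed
qed

lemma centred_exponent_scaled:
  assumes N: "sets N = sets borel" and t: "0 < t"
  shows "centred_exponent a (scaled_levy_measure N t) u = of_real t * centred_exponent a N (u / sqrt t)"
proof -
  have "(CLINT y|scaled_levy_measure N t. iexp (u * y) - 1 - \<i> * of_real (u * y))
      = t *\<^sub>R (CLINT x|N. iexp (u * (x / sqrt t)) - 1 - \<i> * of_real (u * (x / sqrt t)))"
    by (rule scaled_levy_measure_integral(1)[OF N _ t]) measurable
  also have "\<dots> = of_real t * (CLINT x|N. iexp (u / sqrt t * x) - 1 - \<i> * of_real (u / sqrt t * x))"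
    by (simp only: scaleR_conv_of_real times_divide_eq_left times_divide_eq_right)
  moreover have "of_real (a * u\<^sup>2 / 2) = of_real t * (of_real (a * (u / sqrt t)\<^sup>2 / 2) :: complex)"
  proof -
    have "a * u\<^sup>2 / 2 = t * (a * (u / sqrt t)\<^sup>2 / 2)"
      using t by (simp add: power_divide)
    then show ?thesis by (simp only: of_real_mult)
  qed
  ultimately show ?thesis
    by (simp only: centred_exponent_def distrib_left mult_minus_right)
qed

text \<open>
  The minimum is its second argument for \<open>t \<le> x\<^sup>2\<close> and its first afterwards. Over all positive \<open>t\<close> the two
  pieces integrate to two each, whatever \<open>x \<noteq> 0\<close> is, because the kernel depends on \<open>t / x\<^sup>2\<close> only and \<open>dt / t\<close> is scale
  invariant.
\<close>

lemma nn_integral_time_kernel: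
  fixes x :: real
  shows "(\<integral>\<^sup>+ t\<in>{1..}. ennreal (min (\<bar>x\<bar> / sqrt t) (1 / (\<bar>x\<bar> / sqrt t)) / t) \<partial>lborel) \<le> 4"
proof (cases "x = 0")
  case False
  define b where "b = x\<^sup>2"
  have b: "0 < b" "sqrt b = \<bar>x\<bar>" using False by (auto simp: b_def)
  have "(\<integral>\<^sup>+ t\<in>{1..}. ennreal (min (\<bar>x\<bar> / sqrt t) (1 / (\<bar>x\<bar> / sqrt t)) / t) \<partial>lborel)
     \<le> (\<integral>\<^sup>+ t. ennreal (1 / (\<bar>x\<bar> * sqrt t)) * indicator {0..b} t
          + ennreal (\<bar>x\<bar> / (t * sqrt t)) * indicator {b..} t \<partial>lborel)"
  proof (rule nn_integral_mono)
    fix t :: real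
    show "ennreal (min (\<bar>x\<bar> / sqrt t) (1 / (\<bar>x\<bar> / sqrt t)) / t) * indicator {1..} t
      \<le> ennreal (1 / (\<bar>x\<bar> * sqrt t)) * indicator {0..b} t + ennreal (\<bar>x\<bar> / (t * sqrt t)) * indicator {b..} t"
    proof (cases "1 \<le> t")
      case True
      have "min (\<bar>x\<bar> / sqrt t) (1 / (\<bar>x\<bar> / sqrt t)) / t \<le> 1 / (\<bar>x\<bar> * sqrt t)"
      proof -
        have "min (\<bar>x\<bar> / sqrt t) (1 / (\<bar>x\<bar> / sqrt t)) / t \<le> (1 / (\<bar>x\<bar> / sqrt t)) / t"
          using True by (intro divide_right_mono) auto
        also have "\<dots> = 1 / (\<bar>x\<bar> * sqrt t)"
          using True False real_sqrt_mult_self[of t] by (simp add: field_simps)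
        finally show ?thesis .
      qed
      moreover have "min (\<bar>x\<bar> / sqrt t) (1 / (\<bar>x\<bar> / sqrt t)) / t \<le> \<bar>x\<bar> / (t * sqrt t)"
      proof -
        have "min (\<bar>x\<bar> / sqrt t) (1 / (\<bar>x\<bar> / sqrt t)) / t \<le> (\<bar>x\<bar> / sqrt t) / t"
          using True by (intro divide_right_mono) auto
        then show ?thesis by (simp add: mult.commute)
      qed
      ultimately show ?thesis
        using True by (cases "t \<le> b") (auto simp: ennreal_leI intro!: add_increasing2)
    qed simp
  qed
  also have "\<dots> = (\<integral>\<^sup>+ t. ennreal (1 / (\<bar>x\<bar> * sqrt t)) * indicator {0..b} t \<partial>lborel)
      + (\<integral>\<^sup>+ t. ennreal (\<bar>x\<bar> / (t * sqrt t)) * indicator {b..} t \<partial>lborel)"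
    by (rule nn_integral_add) measurable
  also have "(\<integral>\<^sup>+ t. ennreal (\<bar>x\<bar> / (t * sqrt t)) * indicator {b..} t \<partial>lborel) = ennreal (0 - (- 2 * \<bar>x\<bar> / sqrt b))"
  proof (rule nn_integral_FTC_atLeast)
    show "((\<lambda>t. - 2 * \<bar>x\<bar> / sqrt t) \<longlongrightarrow> 0) at_top"
      by real_asymp
    fix t assume "b \<le> t"
    with b have t: "0 < t" by simp
    then show "((\<lambda>t. - 2 * \<bar>x\<bar> / sqrt t) has_real_derivative \<bar>x\<bar> / (t * sqrt t)) (at t)"
      by (auto intro!: derivative_eq_intros simp: field_simps)
    show "0 \<le> \<bar>x\<bar> / (t * sqrt t)" using t by simp
  qed measurable
  also have "(\<integral>\<^sup>+ t. ennreal (1 / (\<bar>x\<bar> * sqrt t)) * indicator {0..b} t \<partial>lborel) = ennreal 2"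
  proof -
    have "((\<lambda>t. 1 / (\<bar>x\<bar> * sqrt t)) has_integral (2 * sqrt b / \<bar>x\<bar> - 2 * sqrt 0 / \<bar>x\<bar>)) {0..b}"
    proof (rule fundamental_theorem_of_calculus_interior)
      show "continuous_on {0..b} (\<lambda>t. 2 * sqrt t / \<bar>x\<bar>)"
        using False by (intro continuous_intros) auto
      fix t assume "t \<in> {0<..<b}"
      then show "((\<lambda>t. 2 * sqrt t / \<bar>x\<bar>) has_vector_derivative 1 / (\<bar>x\<bar> * sqrt t)) (at t)"
        unfolding has_real_derivative_iff_has_vector_derivative[symmetric] using False
        by (auto intro!: derivative_eq_intros simp: field_simps)
    qed (use b in auto)
    then have "((\<lambda>t. 1 / (\<bar>x\<bar> * sqrt t)) has_integral 2) {0..b}"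
      using b False by simp
    then have "(\<integral>\<^sup>+ t. ennreal (indicator {0..b} t * (1 / (\<bar>x\<bar> * sqrt t))) \<partial>lborel) = ennreal 2"
      by (intro nn_integral_has_integral_lebesgue) auto
    then show ?thesis
      by (simp only: nn_integral_set_ennreal mult.commute[of "indicator _ _"])
  qed
  also have "ennreal 2 + ennreal (0 - (- 2 * \<bar>x\<bar> / sqrt b)) = 4"
    using b False by (simp flip: ennreal_plus)
  finally show ?thesis .
qed simp

text \<open>
  A truncated third absolute moment of the rescaled jumps, cubic for small jumps and linear for
  large ones; it takes the place of the Lyapunov ratio of the classical Berry--Esseen theorem.
\<close>

definition lyapunov_ratio :: "real measure \<Rightarrow> real \<Rightarrow> real" where
  "lyapunov_ratio N t =
     (LINT y|scaled_levy_measure N t. y\<^sup>2 * min \<bar>y\<bar> (1 / \<bar>y\<bar>))"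

text \<open>
  Tonelli's theorem with the bound of \<open>nn_integral_time_kernel\<close>. The weight \<open>x\<^sup>2\<close> is moved into the
  measure \<open>\<rho>\<close>, which is finite even when \<open>N\<close> is not, so that Tonelli's theorem applies to its product with
  Lebesgue measure.
\<close>

lemma lyapunov_ratio_time_integral:
  assumes N[measurable_cong]: "sets N = sets borel" and int: "integrable N (\<lambda>x::real. x\<^sup>2)" and C: "0 \<le> C"
  shows "(\<integral>\<^sup>+ t\<in>{1..}. ennreal (C * lyapunov_ratio N t / t) \<partial>lborel) < \<infinity>"
proof -
  define \<rho> where "\<rho> = density N (\<lambda>x. ennreal (x\<^sup>2))"
  have [measurable_cong]: "sets \<rho> = sets borel"
    by (simp add: \<rho>_def N)
  have mass: "emeasure \<rho> (space \<rho>) = ennreal (LINT x|N. x\<^sup>2)"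
  proof -
    have "emeasure \<rho> (space \<rho>) = (\<integral>\<^sup>+ x. ennreal (x\<^sup>2) * indicator (space N) x \<partial>N)"
      unfolding \<rho>_def by (subst emeasure_density) auto
    also have "\<dots> = (\<integral>\<^sup>+ x. ennreal (x\<^sup>2) \<partial>N)"
      by (intro nn_integral_cong) auto
    also have "\<dots> = ennreal (LINT x|N. x\<^sup>2)"
      using int by (intro nn_integral_eq_integral) auto
    finally show ?thesis .
  qed
  interpret \<rho>: finite_measure \<rho>
    by (rule finite_measureI) (simp add: mass)
  interpret P: pair_sigma_finite lborel \<rho> ..
  let ?k = "\<lambda>t x. min (\<bar>x\<bar> / sqrt t) (1 / (\<bar>x\<bar> / sqrt t)) / t"
  have slice: "ennreal (C * lyapunov_ratio N t / t) * indicator {1..} t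
      = (\<integral>\<^sup>+ x. ennreal C * (ennreal (?k t x) * indicator {1..} t) \<partial>\<rho>)" for t
  proof (cases "1 \<le> t")
    case True
    then have t: "0 < t" by simp
    have i: "integrable N (\<lambda>x. (x / sqrt t)\<^sup>2 * min \<bar>x / sqrt t\<bar> (1 / \<bar>x / sqrt t\<bar>))"
    proof (subst scaled_levy_measure_integral(2)[OF N _ t, symmetric])
      have "integrable (scaled_levy_measure N t) (\<lambda>y. y\<^sup>2)"
        using int t by (subst scaled_levy_measure_integral(2)[OF N _ t]) (auto simp: power_divide)
      then show "integrable (scaled_levy_measure N t) (\<lambda>y. y\<^sup>2 * min \<bar>y\<bar> (1 / \<bar>y\<bar>))"
        by (rule integrable_truncated_third_moment[OF sets_scaled_levy_measure])
    qed measurable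
    have "C * lyapunov_ratio N t / t
        = (LINT x|N. C * ((x / sqrt t)\<^sup>2 * min \<bar>x / sqrt t\<bar> (1 / \<bar>x / sqrt t\<bar>)))"
      unfolding lyapunov_ratio_def
      using t by (subst scaled_levy_measure_integral(1)[OF N _ t]) auto
    then have "ennreal (C * lyapunov_ratio N t / t)
        = (\<integral>\<^sup>+ x. ennreal (C * ((x / sqrt t)\<^sup>2 * min \<bar>x / sqrt t\<bar> (1 / \<bar>x / sqrt t\<bar>))) \<partial>N)"
      using i C by (subst nn_integral_eq_integral) auto
    also have "\<dots> = (\<integral>\<^sup>+ x. ennreal (x\<^sup>2) * (ennreal C * (ennreal (?k t x) * indicator {1..} t)) \<partial>N)"
    proof (rule nn_integral_cong)
      fix x :: real
      define k where "k = ?k t x"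
      have "C * ((x / sqrt t)\<^sup>2 * min \<bar>x / sqrt t\<bar> (1 / \<bar>x / sqrt t\<bar>)) = x\<^sup>2 * (C * k)"
        using t by (simp add: power_divide k_def)
      moreover have "0 \<le> k"
        using t by (simp add: k_def)
      then have "ennreal (x\<^sup>2 * (C * k)) = ennreal (x\<^sup>2) * (ennreal C * ennreal k)"
        using C by (simp add: ennreal_mult)
      ultimately show "ennreal (C * ((x / sqrt t)\<^sup>2 * min \<bar>x / sqrt t\<bar> (1 / \<bar>x / sqrt t\<bar>)))
          = ennreal (x\<^sup>2) * (ennreal C * (ennreal (?k t x) * indicator {1..} t))"
        using True by (simp only: k_def[symmetric]) simp
    qed
    also have "\<dots> = (\<integral>\<^sup>+ x. ennreal C * (ennreal (?k t x) * indicator {1..} t) \<partial>\<rho>)"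
      unfolding \<rho>_def by (rule nn_integral_density[symmetric]) measurable
    finally show ?thesis using True by simp
  qed simp
  have "(\<integral>\<^sup>+ t\<in>{1..}. ennreal (C * lyapunov_ratio N t / t) \<partial>lborel)
      = (\<integral>\<^sup>+ t. \<integral>\<^sup>+ x. ennreal C * (ennreal (?k t x) * indicator {1..} t) \<partial>\<rho> \<partial>lborel)"
    by (simp only: slice)
  also have "\<dots> = (\<integral>\<^sup>+ x. \<integral>\<^sup>+ t. ennreal C * (ennreal (?k t x) * indicator {1..} t) \<partial>lborel \<partial>\<rho>)"
    by (rule P.Fubini'[symmetric]) measurable
  also have "\<dots> \<le> (\<integral>\<^sup>+ x. ennreal C * 4 \<partial>\<rho>)"
  proof (rule nn_integral_mono)
    fix x :: real
    have "(\<integral>\<^sup>+ t. ennreal C * (ennreal (?k t x) * indicator {1..} t) \<partial>lborel)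
        = ennreal C * (\<integral>\<^sup>+ t\<in>{1..}. ennreal (?k t x) \<partial>lborel)"
      by (rule nn_integral_cmult) measurable
    also have "\<dots> \<le> ennreal C * 4"
      by (intro mult_left_mono nn_integral_time_kernel) simp
    finally show "(\<integral>\<^sup>+ t. ennreal C * (ennreal (?k t x) * indicator {1..} t) \<partial>lborel) \<le> ennreal C * 4" .
  qed
  also have "\<dots> = ennreal C * 4 * ennreal (LINT x|N. x\<^sup>2)"
    by (simp add: mass)
  also have "\<dots> < \<infinity>"
    by (simp add: ennreal_mult_less_top)
  finally show ?thesis .
qed

section \<open>Truncated second moments of the Levy measure\<close>

text \<open>
  Rewritten as the variance of the Gaussian part and the small jumps, \<open>\<sigma>\<^sub>t\<close> is visibly nondecreasing
  in \<open>t\<close> for \<open>\<kappa> \<ge> 0\<close>.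
\<close>

lemma truncated_sigma_eq:
  assumes N: "sets N = sets borel" and int: "integrable N (\<lambda>x::real. x\<^sup>2)"
    and \<sigma>: "\<sigma>\<^sup>2 = a + (LINT x|N. x\<^sup>2)"
  shows "truncated_sigma N \<kappa> \<sigma> t = sqrt (a + (LINT x:{- \<kappa> * sqrt t<..<\<kappa> * sqrt t}|N. x\<^sup>2))"
proof -
  let ?I = "{- \<kappa> * sqrt t<..<\<kappa> * sqrt t}"
  note [measurable_cong] = N
  have si: "set_integrable N A (\<lambda>x. x\<^sup>2)" if "A \<in> sets borel" for A
    using that integrable_mult_indicator[OF _ int, of A] N by (simp add: set_integrable_def)
  have "(LINT x|N. x\<^sup>2) = (LINT x:?I \<union> - ?I|N. x\<^sup>2)"
    by (simp add: set_lebesgue_integral_def)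
  also have "\<dots> = (LINT x:?I|N. x\<^sup>2) + (LINT x:- ?I|N. x\<^sup>2)"
    by (intro set_integral_Un si) auto
  finally show ?thesis
    by (simp add: truncated_sigma_def \<sigma>)
qed

lemma truncated_second_moment_mono:
  assumes N: "sets N = sets borel" and int: "integrable N (\<lambda>x::real. x\<^sup>2)"
    and AB: "A \<subseteq> B" "A \<in> sets borel" "B \<in> sets borel"
  shows "(LINT x:A|N. x\<^sup>2) \<le> (LINT x:B|N. x\<^sup>2)"
  unfolding set_lebesgue_integral_def
  using AB(1) by (intro integral_mono integrable_mult_indicator int) (auto simp: N AB(2,3) indicator_def)

lemma scaled_truncated_second_moment:
  assumes N: "sets N = sets borel" and t: "0 < t"
  shows "(LINT y:{- \<kappa><..<\<kappa>}|scaled_levy_measure N t. y\<^sup>2)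
    = (LINT x:{- \<kappa> * sqrt t<..<\<kappa> * sqrt t}|N. x\<^sup>2)"
proof -
  have "indicator {- \<kappa><..<\<kappa>} (x / sqrt t) = (indicator {- \<kappa> * sqrt t<..<\<kappa> * sqrt t} x :: real)" for x
    using t by (auto simp: indicator_def field_simps)
  then show ?thesis
    unfolding set_lebesgue_integral_def
    using t by (subst scaled_levy_measure_integral(1)[OF N _ t]) (simp_all add: power_divide)
qed

lemma truncated_second_moment_pos:
  assumes "levy_measure N" and "integrable N (\<lambda>x. x\<^sup>2)" and pos: "0 < emeasure N {- \<kappa><..<\<kappa>}"
  shows "0 < (LINT x:{- \<kappa><..<\<kappa>}|N. x\<^sup>2)"
proof -
  have N[measurable_cong]: "sets N = sets borel" and zero: "emeasure N {0} = 0"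
    using assms by (auto simp: levy_measure_def)
  let ?f = "\<lambda>x. indicator {- \<kappa><..<\<kappa>} x *\<^sub>R x\<^sup>2"
  have int: "integrable N ?f"
    using assms(2) by (intro integrable_mult_indicator) (auto simp: N)
  have "integral\<^sup>L N ?f \<noteq> 0"
  proof
    assume "integral\<^sup>L N ?f = 0"
    then have "AE x in N. ?f x = 0"
      using integral_nonneg_eq_0_iff_AE[OF int] by simp
    moreover have "AE x in N. x \<noteq> 0"
      using zero by (intro AE_I[of _ _ "{0}"]) (auto simp: N)
    ultimately have "AE x in N. x \<notin> {- \<kappa><..<\<kappa>}"
      by eventually_elim (auto simp: indicator_def split: if_splits)
    then have "emeasure N {- \<kappa><..<\<kappa>} = 0"
      using emeasure_eq_0_AE[of "\<lambda>x. x \<in> {- \<kappa><..<\<kappa>}" N]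
      by (simp only: sets_eq_imp_space_eq[OF N] space_borel UNIV_I simp_thms Collect_mem_eq)
    with pos show False by simp
  qed
  moreover have "0 \<le> integral\<^sup>L N ?f"
    by (intro Bochner_Integration.integral_nonneg_AE) simp
  ultimately have "0 < integral\<^sup>L N ?f"
    by linarith
  then show ?thesis
    by (simp only: set_lebesgue_integral_def)
qed

section \<open>Measurability in time\<close>

text \<open>
  The distribution function itself need not be continuous in the parameter. Expectations of
  continuous steps are, by Levy's continuity theorem, and they approximate it from above
  by right-continuity.
\<close>

lemma cdf_measurable_in_parameter:
  fixes \<mu> :: "real \<Rightarrow> real measure"
  assumes dist: "\<And>t. t \<in> S \<Longrightarrow> real_distribution (\<mu> t)"
    and char: "\<And>u. continuous_on S (\<lambda>t. char (\<mu> t) u)"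
  shows "(\<lambda>t. cdf (\<mu> t) x) \<in> borel_measurable (restrict_space borel S)"
proof (rule borel_measurable_LIMSEQ_real)
  let ?f = "\<lambda>n. cts_step x (x + 1 / real (Suc n))"
  show "(\<lambda>t. integral\<^sup>L (\<mu> t) (?f n)) \<in> borel_measurable (restrict_space borel S)" for n
  proof (rule borel_measurable_continuous_on_restrict)
    show "continuous_on S (\<lambda>t. integral\<^sup>L (\<mu> t) (?f n))"
      unfolding continuous_on_sequentially comp_def
    proof safe
      fix w t assume w: "\<forall>k::nat. w k \<in> S" "w \<longlonglongrightarrow> t" and t: "t \<in> S"
      have "weak_conv_m (\<lambda>k. \<mu> (w k)) (\<mu> t)"
        using w t by (intro levy_continuity dist continuous_on_tendsto_compose[OF char]) auto
      then show "(\<lambda>k. integral\<^sup>L (\<mu> (w k)) (?f n)) \<longlonglongrightarrow> integral\<^sup>L (\<mu> t) (?f n)"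
      proof (rule weak_conv_imp_integral_bdd_continuous_conv[rotated 2])
        show "isCont (?f n) y" for y
          using uniformly_continuous_imp_continuous[OF cts_step_uniformly_continuous[of x "x + 1 / real (Suc n)"]]
          by (auto simp: continuous_on_eq_continuous_at)
        show "norm (?f n y) \<le> 1" for y
          by (auto simp: cts_step_def divide_simps)
      qed (use w t dist in auto)
    qed
  qed
  fix t assume "t \<in> space (restrict_space borel S)"
  then have "t \<in> S" by (simp add: space_restrict_space)
  then interpret real_distribution "\<mu> t" by (rule dist)
  have "(\<lambda>n. cdf (\<mu> t) (x + 1 / real (Suc n))) \<longlonglongrightarrow> cdf (\<mu> t) x"
  proof (rule filterlim_compose[OF cdf_is_right_cont[unfolded continuous_within]])
    have "(\<lambda>n. x + 1 / real (Suc n)) \<longlonglongrightarrow> x"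
      by real_asymp
    then show "filterlim (\<lambda>n. x + 1 / real (Suc n)) (at_right x) sequentially"
      by (auto simp: filterlim_at)
  qed
  then show "(\<lambda>n. integral\<^sup>L (\<mu> t) (?f n)) \<longlonglongrightarrow> cdf (\<mu> t) x"
  proof (rule tendsto_sandwich[OF _ _ tendsto_const, rotated 2])
    show "\<forall>\<^sub>F n in sequentially. cdf (\<mu> t) x \<le> integral\<^sup>L (\<mu> t) (?f n)"
      by (intro always_eventually allI cdf_cts_step) simp
    show "\<forall>\<^sub>F n in sequentially. integral\<^sup>L (\<mu> t) (?f n) \<le> cdf (\<mu> t) (x + 1 / real (Suc n))"
      by (intro always_eventually allI cdf_cts_step) simp
  qed
qed

lemma SUP_rationals_right_continuous:
  fixes f :: "real \<Rightarrow> real"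
  assumes cont: "\<And>x. continuous (at_right x) f" and bdd: "bdd_above (range f)"
  shows "(SUP x. f x) = (SUP x\<in>\<rat>. f x)"
proof (rule antisym)
  have bddQ: "bdd_above (f ` \<rat>)"
    using bdd by (rule bdd_above_mono) auto
  show "(SUP x\<in>\<rat>. f x) \<le> (SUP x. f x)"
    using bdd by (intro cSUP_subset_mono) auto
  show "(SUP x. f x) \<le> (SUP x\<in>\<rat>. f x)"
  proof (rule cSUP_least)
    fix x
    show "f x \<le> (SUP x\<in>\<rat>. f x)"
    proof (rule ccontr)
      assume "\<not> f x \<le> (SUP x\<in>\<rat>. f x)"
      then have "\<forall>\<^sub>F y in at_right x. (SUP x\<in>\<rat>. f x) < f y"
        using cont[of x] by (intro order_tendstoD(1)[of f "f x"]) (auto simp: continuous_within)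
      then obtain b where b: "x < b" "\<And>y. x < y \<Longrightarrow> y < b \<Longrightarrow> (SUP x\<in>\<rat>. f x) < f y"
        by (auto simp: eventually_at_right_field)
      obtain q where q: "q \<in> \<rat>" "x < q" "q < b"
        using Rats_dense_in_real[OF b(1)] by blast
      with b(2)[of q] cSUP_upper[OF q(1) bddQ] show False by simp
    qed
  qed simp
qed

section \<open>The integrated distance to the Gaussian laws\<close>

text \<open>
  The bound of \<open>berry_esseen_infinitely_divisible\<close> for the rescaled Levy measure. When the ratio is
  zero, arbitrarily small positive upper bounds take its place.
\<close>

lemma levy_berry_esseen:
  assumes N: "sets N = sets borel" "integrable N (\<lambda>x::real. x\<^sup>2)" and a: "0 \<le> a" and t: "1 \<le> t"
    and Y: "real_distribution \<mu>" "\<And>u. char \<mu> u = exp (of_real t * centred_exponent a N (u / sqrt t))"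
    and \<kappa>: "1 \<le> \<kappa>" and c: "0 < c" "c\<^sup>2 \<le> a + (LINT x:{- \<kappa><..<\<kappa>}|N. x\<^sup>2)"
    and A: "0 < A" "3 / 4 \<le> measure fejer_measure {- A..A}"
  shows "\<bar>cdf \<mu> x - \<Phi> (x / sqrt (a + (LINT x:{- \<kappa> * sqrt t<..<\<kappa> * sqrt t}|N. x\<^sup>2)))\<bar>
    \<le> berry_esseen_const A \<kappa> c * lyapunov_ratio N t" (is "\<bar>?d\<bar> \<le> ?K * _")
proof -
  have t0: "0 < t" using t by simp
  have N': "integrable (scaled_levy_measure N t) (\<lambda>y. y\<^sup>2)"
    using N(2) t0 by (subst scaled_levy_measure_integral(2)[OF N(1) _ t0]) (auto simp: power_divide)
  have "\<kappa> * 1 \<le> \<kappa> * sqrt t"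
    using t \<kappa> by (intro mult_left_mono) auto
  then have "(LINT x:{- \<kappa><..<\<kappa>}|N. x\<^sup>2) \<le> (LINT x:{- \<kappa> * sqrt t<..<\<kappa> * sqrt t}|N. x\<^sup>2)"
  proof (intro truncated_second_moment_mono N subsetI)
    fix x assume "x \<in> {- \<kappa><..<\<kappa>}"
    with \<open>\<kappa> * 1 \<le> \<kappa> * sqrt t\<close> show "x \<in> {- \<kappa> * sqrt t<..<\<kappa> * sqrt t}"
      unfolding greaterThanLessThan_iff by linarith
  qed auto
  then have c': "c\<^sup>2 \<le> a + (LINT x:{- \<kappa> * sqrt t<..<\<kappa> * sqrt t}|N. x\<^sup>2)"
    using c by simp
  have bound: "\<bar>?d\<bar> \<le> ?K * r" if "lyapunov_ratio N t \<le> r" "0 < r" for r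
    by (rule berry_esseen_infinitely_divisible[OF Y(1) _ sets_scaled_levy_measure N' a \<kappa> c(1) A _ c'
          that[unfolded lyapunov_ratio_def]])
       (simp_all only: Y(2) centred_exponent_scaled[OF N(1) t0] scaled_truncated_second_moment[OF N(1) t0])
  have ratio: "0 \<le> lyapunov_ratio N t"
    by (simp add: lyapunov_ratio_def)
  show ?thesis
  proof (cases "lyapunov_ratio N t = 0")
    case False
    with ratio show ?thesis by (intro bound) auto
  next
    case True
    have "0 \<le> ?K"
      using A(1) c(1) by (intro berry_esseen_const_nonneg) auto
    have "\<bar>?d\<bar> \<le> 0 + e" if e: "0 < e" for e
    proof -
      have "\<bar>?d\<bar> \<le> ?K * (e / (?K + 1))"
        using True e \<open>0 \<le> ?K\<close> by (intro bound) auto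
      also have "\<dots> \<le> e"
        using e \<open>0 \<le> ?K\<close> by (simp add: field_simps)
      finally show ?thesis by simp
    qed
    then have "\<bar>?d\<bar> \<le> 0"
      by (rule field_le_epsilon)
    then show ?thesis
      using True by simp
  qed
qed

theorem theorem1p1:
  fixes M :: "'a measure" and X :: "real \<Rightarrow> 'a \<Rightarrow> real"
    and \<nu> :: "real measure" and \<sigma> \<kappa> :: real
  assumes "levy_process M X"
    and "integrable M (X 1)" and "(LINT \<omega>|M. X 1 \<omega>) = 0"
    and "integrable M (\<lambda>\<omega>. (X 1 \<omega>)\<^sup>2)"
    and "\<sigma> = sqrt (LINT \<omega>|M. (X 1 \<omega>)\<^sup>2)" and "0 < \<sigma>"
    and "levy_measure_of M X \<nu>"
    and "if \<nu> \<noteq> null_measure borel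
         then 1 \<le> \<kappa> \<and> 0 < emeasure \<nu> {- \<kappa> <..< \<kappa>}
         else \<kappa> = 1"
  shows "set_integrable lborel {1..}
    (\<lambda>t. (SUP x::real. \<bar>measure M {\<omega> \<in> space M. X t \<omega> / sqrt t \<le> x}
                        - \<Phi> (x / truncated_sigma \<nu> \<kappa> \<sigma> t)\<bar>) / t)"
proof -
  interpret levy_process M X by fact
  have X[measurable]: "X t \<in> borel_measurable M" if "0 \<le> t" for t
    using that by (rule measurable_X)
  obtain \<gamma> a where a: "0 \<le> a" and \<nu>: "levy_measure \<nu>"
    and char: "\<And>t u. 0 \<le> t \<Longrightarrow> char (distr M borel (X t)) u
        = exp (of_real t * levy_khintchine_exponent \<gamma> a \<nu> u)"
    using assms(7) by (auto simp: levy_measure_of_def generating_triplet_def)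
  have N: "sets \<nu> = sets borel"
    using \<nu> by (simp add: levy_measure_def)
  have [measurable]: "X 1 \<in> borel_measurable M" by (rule X) simp
  have moments: "integrable (distr M borel (X 1)) (\<lambda>x. x)" "(LINT x|distr M borel (X 1). x) = 0"
    "integrable (distr M borel (X 1)) (\<lambda>x. x\<^sup>2)"
    using assms(2-4) by (simp_all add: integrable_distr_eq integral_distr)
  have "(LINT x|distr M borel (X 1). x\<^sup>2) = \<sigma>\<^sup>2"
    by (simp add: assms(5) integral_distr)
  note variance = levy_measure_second_moment[OF \<nu> a real_distribution_distr[OF \<open>X 1 \<in> borel_measurable M\<close>]
      _ moments, of \<gamma>, unfolded this]
  have char1: "char (distr M borel (X 1)) u = exp (levy_khintchine_exponent \<gamma> a \<nu> u)" for u
    using char[of 1 u] by simp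
  note int = variance(1)[OF char1] and \<sigma>2 = variance(2)[OF char1, symmetric]
    and exponent = variance(3)[OF char1]
  note sigma_t = truncated_sigma_eq[OF N int \<sigma>2]
  have \<kappa>: "1 \<le> \<kappa>"
    using assms(8) by (auto split: if_splits)
  have pos: "0 < a + (LINT x:{- \<kappa><..<\<kappa>}|\<nu>. x\<^sup>2)"
  proof (cases "\<nu> = null_measure borel")
    case True
    have "0 < \<sigma>\<^sup>2" using assms(6) by simp
    then show ?thesis
      using True \<sigma>2 by (simp add: set_lebesgue_integral_def)
  next
    case False
    then show ?thesis
      using assms(8) a truncated_second_moment_pos[OF \<nu> int] by (simp add: add_nonneg_pos)
  qed
  \<comment> \<open>This is \<open>\<sigma>\<^sub>1\<close>, the lower bound for all \<open>\<sigma>\<^sub>t\<close> with \<open>t \<ge> 1\<close>.\<close>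
  define c where "c = sqrt (a + (LINT x:{- \<kappa><..<\<kappa>}|\<nu>. x\<^sup>2))"
  have c: "0 < c" "c\<^sup>2 \<le> a + (LINT x:{- \<kappa><..<\<kappa>}|\<nu>. x\<^sup>2)"
    using pos by (simp_all add: c_def)
  obtain A where A: "0 < A" "3 / 4 \<le> measure fejer_measure {- A..A}"
    using fejer_measure_tight by blast
  define K where "K = berry_esseen_const A \<kappa> c"
  define \<mu> where "\<mu> t = distr M borel (\<lambda>\<omega>. X t \<omega> / sqrt t)" for t
  define D where "D t x = \<bar>cdf (\<mu> t) x - \<Phi> (x / truncated_sigma \<nu> \<kappa> \<sigma> t)\<bar>" for t x
  have \<mu>: "real_distribution (\<mu> t)" if "1 \<le> t" for t
    using that by (auto simp: \<mu>_def)
  have cdf_\<mu>: "cdf (\<mu> t) x = measure M {\<omega> \<in> space M. X t \<omega> / sqrt t \<le> x}" if "1 \<le> t" for t x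
    unfolding cdf_def \<mu>_def using that
    by (subst measure_distr) (auto intro!: arg_cong[where f = "measure M"])
  have char_\<mu>: "char (\<mu> t) u = exp (of_real t * centred_exponent a \<nu> (u / sqrt t))" if "1 \<le> t" for t u
  proof -
    have "char (\<mu> t) u = char (distr M borel (X t)) (u / sqrt t)"
      using that by (simp add: \<mu>_def char_def integral_distr)
    then show ?thesis
      using that by (simp add: char exponent)
  qed
  have D_le: "D t x \<le> K * lyapunov_ratio \<nu> t" if "1 \<le> t" for t x
    unfolding D_def K_def sigma_t
    by (rule levy_berry_esseen[OF N int a that \<mu>[OF that] char_\<mu>[OF that] \<kappa> c A])
  have bdd: "bdd_above (range (D t))" if "1 \<le> t" for t
    using D_le[OF that] by (auto intro!: bdd_aboveI)
  have SUP_le: "0 \<le> (SUP x. D t x)" "(SUP x. D t x) \<le> K * lyapunov_ratio \<nu> t" if "1 \<le> t" for t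
  proof -
    show "(SUP x. D t x) \<le> K * lyapunov_ratio \<nu> t"
      by (rule cSUP_least) (use D_le[OF that] in auto)
    have "0 \<le> D t 0" by (simp add: D_def)
    also have "\<dots> \<le> (SUP x. D t x)"
      by (rule cSUP_upper[OF _ bdd[OF that]]) simp
    finally show "0 \<le> (SUP x. D t x)" .
  qed
  have isCont_\<Phi>: "isCont \<Phi> x" for x
    unfolding continuous_at_eps_delta
    using std_normal_cdf_lipschitz by (auto simp: dist_real_def intro: le_less_trans)
  have SUP_rat: "(SUP x. D t x) = (SUP x\<in>\<rat>. D t x)" if "1 \<le> t" for t
  proof (rule SUP_rationals_right_continuous[OF _ bdd[OF that]])
    interpret \<mu>: real_distribution "\<mu> t" by (rule \<mu>[OF that])
    have "isCont (\<lambda>x. \<Phi> (x / truncated_sigma \<nu> \<kappa> \<sigma> t)) x" for x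
      by (intro isCont_o2[OF _ isCont_\<Phi>]) (simp add: divide_inverse)
    note \<Phi>_scaled = continuous_at_imp_continuous_within[OF this]
    have D_eq: "D t = (\<lambda>x. \<bar>cdf (\<mu> t) x - \<Phi> (x / truncated_sigma \<nu> \<kappa> \<sigma> t)\<bar>)"
      by (simp add: D_def fun_eq_iff)
    show "continuous (at_right x) (D t)" for x
      unfolding D_eq by (rule continuous_rabs[OF continuous_diff[OF \<mu>.cdf_is_right_cont \<Phi>_scaled]])
  qed
  have [measurable]: "truncated_sigma \<nu> \<kappa> \<sigma> \<in> borel_measurable (restrict_space borel {1..})"
  proof (intro measurable_restrict_space1 borel_measurable_mono monoI)
    fix s t :: real assume "s \<le> t"
    then have "\<kappa> * sqrt s \<le> \<kappa> * sqrt t"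
      using \<kappa> by (intro mult_left_mono) auto
    then show "truncated_sigma \<nu> \<kappa> \<sigma> s \<le> truncated_sigma \<nu> \<kappa> \<sigma> t"
      unfolding sigma_t by (intro real_sqrt_le_mono add_left_mono truncated_second_moment_mono N int) auto
  qed
  have [measurable]: "\<Phi> \<in> borel_measurable borel"
    by (intro borel_measurable_continuous_onI continuous_at_imp_continuous_on ballI isCont_\<Phi>)
  have [measurable]: "(\<lambda>t. cdf (\<mu> t) x) \<in> borel_measurable (restrict_space borel {1..})" for x
  proof (rule cdf_measurable_in_parameter)
    fix u
    have "continuous_on {1..} (\<lambda>t. exp (of_real t * centred_exponent a \<nu> (u / sqrt t)))"
    proof (intro continuous_on_exp continuous_on_mult continuous_on_of_real continuous_on_id)
      have "continuous_on UNIV (centred_exponent a \<nu>)"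
        by (intro continuous_at_imp_continuous_on ballI isCont_centred_exponent N int)
      moreover have "continuous_on {1..} (\<lambda>t. u / sqrt t)"
        by (intro continuous_intros) auto
      ultimately show "continuous_on {1..} (\<lambda>t. centred_exponent a \<nu> (u / sqrt t))"
        by (rule continuous_on_compose2) simp
    qed
    then show "continuous_on {1..} (\<lambda>t. char (\<mu> t) u)"
      by (rule continuous_on_eq) (simp add: char_\<mu>)
  qed (simp add: \<mu>)
  have "(\<lambda>t. (SUP x\<in>\<rat>. D t x) / t) \<in> borel_measurable (restrict_space borel {1..})"
  proof (intro borel_measurable_divide borel_measurable_cSUP)
    show "(\<lambda>t. D t x) \<in> borel_measurable (restrict_space borel {1..})" for x
      unfolding D_def by measurable
    show "bdd_above ((\<lambda>x. D t x) ` \<rat>)" if "t \<in> space (restrict_space borel {1..})" for t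
      using that by (intro bdd_above_mono[OF bdd[of t]]) (auto simp: space_restrict_space)
    show "(\<lambda>t. t) \<in> borel_measurable (restrict_space borel {1..})"
      by (rule measurable_restrict_space1) measurable
  qed (rule countable_rat)
  then have "(\<lambda>t. indicator {1..} t *\<^sub>R ((SUP x\<in>\<rat>. D t x) / t)) \<in> borel_measurable borel"
    by (subst (asm) borel_measurable_restrict_space_iff) auto
  also have "(\<lambda>t. indicator {1..} t *\<^sub>R ((SUP x\<in>\<rat>. D t x) / t))
      = (\<lambda>t. indicator {1..} t *\<^sub>R ((SUP x. D t x) / t))"
    by (auto simp: fun_eq_iff SUP_rat split: split_indicator)
  finally have meas: "(\<lambda>t. indicator {1..} t *\<^sub>R ((SUP x. D t x) / t)) \<in> borel_measurable borel" .
  have "integrable lborel (\<lambda>t. indicator {1..} t *\<^sub>R ((SUP x. D t x) / t))"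
  proof (rule integrableI_bounded)
    have "(\<integral>\<^sup>+ t. ennreal (norm (indicator {1..} t *\<^sub>R ((SUP x. D t x) / t))) \<partial>lborel)
       \<le> (\<integral>\<^sup>+ t\<in>{1..}. ennreal (K * lyapunov_ratio \<nu> t / t) \<partial>lborel)"
      using SUP_le by (intro nn_integral_mono) (auto simp: indicator_def intro!: ennreal_leI divide_right_mono)
    also have "\<dots> < \<infinity>"
    proof (rule lyapunov_ratio_time_integral[OF N int])
      show "0 \<le> K"
        unfolding K_def using A(1) c(1) by (intro berry_esseen_const_nonneg) auto
    qed
    finally show "(\<integral>\<^sup>+ t. ennreal (norm (indicator {1..} t *\<^sub>R ((SUP x. D t x) / t))) \<partial>lborel) < \<infinity>" .
  qed (use meas in simp)
  then have "set_integrable lborel {1..} (\<lambda>t. (SUP x. D t x) / t)"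
    by (simp add: set_integrable_def)
  also have "?this \<longleftrightarrow> ?thesis"
    by (rule set_integrable_cong) (auto simp: D_def cdf_\<mu>)
  finally show ?thesis .
qed

end
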